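(* Let $\Pi=(\mathcal P,\mathcal L)$ be a polar space of rank $n$, let $t$ be an integer satisfying $n\ge 2t\ge 4$, and let $k=n-t-1$. Let $\Gamma''_k(\Pi)=(\mathcal G_k(\Pi),\mathfrak R_{0,t})$ be the graph whose vertices are the $k$-dimensional singular subspaces of $\Pi$ and in which $X,Y$ are adjacent if and only if $\dim_p(X^\perp\cap Y)=k$ and $\dim_p(X\cap Y)=k-t$ (equivalently, $X$ and $Y$ span a maximal singular subspace of $\Pi$). Then every automorphism of the graph $\Gamma''_{n-t-1}(\Pi)$ is induced by an automorphism of $\Pi$.
   Context: A partial linear space is a pair $(\mathcal P,\mathcal L)$, where $\mathcal P$ is a non-empty set of points and $\mathcal L$ is a family of proper subsets of $\mathcal P$ (lines), such that each line contains at least two points and any two distinct collinear points (distinct points lying on a common line) lie on exactly one line. A subspace is a set $S\subset\mathcal P$ containing the line through any two distinct collinear points of $S$; it is singular if any two of its distinct points are collinear (the empty set and single points are singular subspaces). A polar space is a partial linear space such that: (P1) each line contains at least three points; (P2) no point is collinear to all points; (P3) if $p$ is a point and $L$ a line, then $p$ is collinear to exactly one point or to all points of $L$; (P4) every flag formed by singular subspaces is finite. It has rank $n$ ($n\ge 3$) if its maximal singular subspaces are projective spaces of dimension $n-1$. $\dim_p$ denotes projective dimension ($\dim_p\emptyset=-1$, points have dimension $0$). $\mathcal G_k(\Pi)$ is the set of singular subspaces of projective dimension $k$. For $X\subset\mathcal P$, $X^\perp$ is the set of points collinear to all points of $X$ (a point counts as collinear to itself). Singular subspaces $X,Y$ with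 every point of $X$ collinear to every point of $Y$ span the minimal singular subspace $\langle X\cup Y\rangle$ containing them. An automorphism of $\Pi$ is a bijective transformation of $\mathcal P$ preserving $\mathcal L$; it induces the transformation $S\mapsto\varphi(S)$ of $\mathcal G_k(\Pi)$. *)

theory Defs
  imports Main
begin

text \<open>
  A point-line geometry is given by a point set \<open>P\<close> and a set \<open>L\<close> of lines,
  each line being a set of points. Every point counts as collinear to itself.
\<close>

definition collinear :: "'a set \<Rightarrow> 'a set set \<Rightarrow> 'a \<Rightarrow> 'a \<Rightarrow> bool" where
  "collinear P L x y \<longleftrightarrow> x \<in> P \<and> y \<in> P \<and> (x = y \<or> (\<exists>l\<in>L. x \<in> l \<and> y \<in> l))"

definition subspace :: "'a set \<Rightarrow> 'a set set \<Rightarrow> 'a set \<Rightarrow> bool" where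
  "subspace P L S \<longleftrightarrow> S \<subseteq> P \<and>
     (\<forall>x\<in>S. \<forall>y\<in>S. \<forall>l\<in>L. x \<noteq> y \<and> x \<in> l \<and> y \<in> l \<longrightarrow> l \<subseteq> S)"

definition singular_subspace :: "'a set \<Rightarrow> 'a set set \<Rightarrow> 'a set \<Rightarrow> bool" where
  "singular_subspace P L S \<longleftrightarrow> subspace P L S \<and> (\<forall>x\<in>S. \<forall>y\<in>S. collinear P L x y)"

definition maximal_singular :: "'a set \<Rightarrow> 'a set set \<Rightarrow> 'a set \<Rightarrow> bool" where
  "maximal_singular P L M \<longleftrightarrow> singular_subspace P L M \<and>
     (\<forall>S. singular_subspace P L S \<and> M \<subseteq> S \<longrightarrow> S = M)"

definition perp :: "'a set \<Rightarrow> 'a set set \<Rightarrow> 'a set \<Rightarrow> 'a set" where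
  "perp P L X = {p \<in> P. \<forall>x\<in>X. collinear P L p x}"

definition span :: "'a set \<Rightarrow> 'a set set \<Rightarrow> 'a set \<Rightarrow> 'a set" where
  "span P L X = \<Inter>{S. subspace P L S \<and> X \<subseteq> S}"

definition finitely_generated :: "'a set \<Rightarrow> 'a set set \<Rightarrow> 'a set \<Rightarrow> bool" where
  "finitely_generated P L S \<longleftrightarrow> (\<exists>B\<subseteq>S. finite B \<and> span P L B = S)"

text \<open>
  The projective dimension is one less than the least number of points generating
  the subspace. It is only meaningful for finitely generated \<open>S\<close>; all singular
  subspaces of a polar space are finitely generated, because their flags are finite.
\<close>

definition pdim :: "'a set \<Rightarrow> 'a set set \<Rightarrow> 'a set \<Rightarrow> int" where
  "pdim P L S = int (LEAST m. \<exists>B\<subseteq>S. finite B \<and> card B = m \<and> span P L B = S) - 1"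

locale partial_linear_space =
  fixes P :: "'a set" and L :: "'a set set"
  assumes points_nonempty: "P \<noteq> {}"
    and line_proper: "l \<in> L \<Longrightarrow> l \<subset> P"
    and line_two_points: "l \<in> L \<Longrightarrow> \<exists>x\<in>l. \<exists>y\<in>l. x \<noteq> y"
    and line_unique: "\<lbrakk>x \<noteq> y; l \<in> L; m \<in> L; x \<in> l; y \<in> l; x \<in> m; y \<in> m\<rbrakk> \<Longrightarrow> l = m"

locale projective_space = partial_linear_space +
  assumes all_collinear: "\<lbrakk>x \<in> P; y \<in> P\<rbrakk> \<Longrightarrow> collinear P L x y"
    and line_three_points: "l \<in> L \<Longrightarrow> \<exists>x\<in>l. \<exists>y\<in>l. \<exists>z\<in>l. x \<noteq> y \<and> x \<noteq> z \<and> y \<noteq> z"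
    and veblen_young: "\<lbrakk>distinct [a, b, c, d]; ab \<in> L; cd \<in> L; ac \<in> L; bd \<in> L;
        {a, b} \<subseteq> ab; {c, d} \<subseteq> cd; {a, c} \<subseteq> ac; {b, d} \<subseteq> bd; ab \<inter> cd \<noteq> {}\<rbrakk>
      \<Longrightarrow> ac \<inter> bd \<noteq> {}"

locale polar_space = partial_linear_space +
  assumes P1: "l \<in> L \<Longrightarrow> \<exists>x\<in>l. \<exists>y\<in>l. \<exists>z\<in>l. x \<noteq> y \<and> x \<noteq> z \<and> y \<noteq> z"
    and P2: "p \<in> P \<Longrightarrow> \<exists>q\<in>P. \<not> collinear P L p q"
    and P3: "\<lbrakk>p \<in> P; l \<in> L\<rbrakk> \<Longrightarrow>
      (\<exists>!q. q \<in> l \<and> collinear P L p q) \<or> (\<forall>q\<in>l. collinear P L p q)"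
    and P4: "subset.chain {S. singular_subspace P L S} F \<Longrightarrow> finite F"

text \<open>
  Lines are proper subsets of the point set, so a single line with its points is not a
  \<open>projective_space\<close> here. This does not matter below, as \<open>n \<ge> 3\<close> makes the maximal
  singular subspaces at least planes.
\<close>

locale polar_space_of_rank = polar_space +
  fixes n :: nat
  assumes rank_ge_3: "n \<ge> 3"
    and maximal_projective: "maximal_singular P L M \<Longrightarrow> projective_space M {l \<in> L. l \<subseteq> M}"
    and maximal_finitely_generated: "maximal_singular P L M \<Longrightarrow> finitely_generated P L M"
    and maximal_pdim: "maximal_singular P L M \<Longrightarrow> pdim P L M = int n - 1"

definition polar_grassmannian :: "'a set \<Rightarrow> 'a set set \<Rightarrow> int \<Rightarrow> 'a set set" where
  "polar_grassmannian P L k = {S. singular_subspace P L S \<and> pdim P L S = k}"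

text \<open>The relation \<open>\<RR>\<^sub>0\<^sub>,\<^sub>t\<close> on the \<open>k\<close>-dimensional singular subspaces.\<close>

definition rel_0 :: "'a set \<Rightarrow> 'a set set \<Rightarrow> int \<Rightarrow> int \<Rightarrow> ('a set \<times> 'a set) set" where
  "rel_0 P L k t = {(X, Y). X \<in> polar_grassmannian P L k \<and> Y \<in> polar_grassmannian P L k \<and>
     pdim P L (perp P L X \<inter> Y) = k \<and> pdim P L (X \<inter> Y) = k - t}"

definition graph_automorphism :: "'v set \<Rightarrow> ('v \<times> 'v) set \<Rightarrow> ('v \<Rightarrow> 'v) \<Rightarrow> bool" where
  "graph_automorphism V R f \<longleftrightarrow> bij_betw f V V \<and>
     (\<forall>X\<in>V. \<forall>Y\<in>V. (X, Y) \<in> R \<longleftrightarrow> (f X, f Y) \<in> R)"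

definition geometry_automorphism :: "'a set \<Rightarrow> 'a set set \<Rightarrow> ('a \<Rightarrow> 'a) \<Rightarrow> bool" where
  "geometry_automorphism P L \<phi> \<longleftrightarrow> bij_betw \<phi> P P \<and> (\<lambda>l. \<phi> ` l) ` L = L"

lemma pdim_empty: "pdim P L {} = -1"
proof -
  have "span P L {} = {}"
    by (auto simp: span_def subspace_def)
  then have "(LEAST m. \<exists>B\<subseteq>{}. finite B \<and> card B = m \<and> span P L B = {}) = 0"
    by (intro Least_equality) auto
  then show ?thesis
    by (simp add: pdim_def)
qed

lemma pdim_point:
  assumes "p \<in> P"
  shows "pdim P L {p} = 0"
proof -
  have "subspace P L {p}"
    using assms by (auto simp: subspace_def)
  then have span_p: "span P L {p} = {p}"
    by (auto simp: span_def)
  have span_empty: "span P L {} = {}"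
    by (auto simp: span_def subspace_def)
  have "(LEAST m. \<exists>B\<subseteq>{p}. finite B \<and> card B = m \<and> span P L B = {p}) = 1"
  proof (rule Least_equality)
    show "\<exists>B\<subseteq>{p}. finite B \<and> card B = 1 \<and> span P L B = {p}"
      using span_p by (intro exI[of _ "{p}"]) auto
  next
    fix m assume "\<exists>B\<subseteq>{p}. finite B \<and> card B = m \<and> span P L B = {p}"
    then obtain B where B: "finite B" "card B = m" "span P L B = {p}" by blast
    then have "B \<noteq> {}" using span_empty by auto
    then show "1 \<le> m" using B by (metis card_gt_0_iff One_nat_def Suc_leI)
  qed
  then show ?thesis
    by (simp add: pdim_def)
qed

end

theory Submission
  imports Defs
begin

text \<open>
  Speak of rank instead of projective dimension: a vertex is a singular subspace of rank
  \<open>m = n - t\<close>, and two vertices are adjacent if and only if they span a maximal singular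
  subspace, whose rank is \<open>n\<close> (\<open>rel_0_eq_spanning\<close>). The proof recovers from the graph the
  maximal singular subspaces with their incidence to the vertices, and from these the points.

  Every edge \<open>X Z\<close> spans one maximal singular subspace \<open>M\<close>, and every triangle lies in one
  (\<open>spanning_triangle\<close>). So a graph automorphism \<open>f\<close> permutes the maximal singular subspaces,
  provided that all edges spanning the same \<open>M\<close> are linked through triangles: then all pairs
  \<open>f X\<close>, \<open>f Z\<close> with \<open>X\<close>, \<open>Z\<close> spanning \<open>M\<close> span the same \<open>g M\<close>. Two edges \<open>X A\<close> and \<open>X B\<close>, where
  \<open>A\<close> and \<open>B\<close> meet in a hyperplane of both, have a common neighbour. Over large fields this is
  a matter of general position, but lines may have only three points, and the argument needs
  a point of \<open>A \<inter> B\<close> outside \<open>X\<close>, which exists because \<open>t \<ge> 2\<close> (\<open>common_complement_three\<close>).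
  As the supplements of \<open>X\<close> in \<open>M\<close> are connected (\<open>supplement_chain\<close>) and any two vertices in
  \<open>M\<close> have a common neighbour (\<open>common_complement\<close>), all edges spanning \<open>M\<close> are linked. The
  condition \<open>n \<ge> 2 t\<close> makes the vertices large enough for two of them to span \<open>M\<close>. The result is
  a permutation \<open>g\<close> of the maximal singular subspaces with \<open>X \<subseteq> M\<close> if and only if \<open>f X \<subseteq> g M\<close>.

  Every singular subspace \<open>U\<close> is the intersection of the maximal ones containing it
  (\<open>maximal_separating\<close>), so its image can only be the intersection of the corresponding
  \<open>g M\<close>; call it \<open>extend g U\<close>. For vertices it is \<open>f U\<close>. It preserves rank for all \<open>U\<close> of rank
  at least \<open>m\<close>, by counting along chains. The main step (\<open>faithful_descend\<close>) passes from rank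
  \<open>i + 1\<close> to rank \<open>i\<close>, as long as \<open>i + 3 \<le> n\<close>: if \<open>X\<close> and \<open>Y\<close> are distinct flats of rank \<open>i + 1\<close>
  through \<open>W\<close> in a common maximal singular subspace, then \<open>extend g X \<inter> extend g Y\<close> does not
  depend on \<open>X\<close> and \<open>Y\<close>. Within one maximal singular subspace this is the fact that three flats
  pairwise meeting in hyperplanes, and not in a common flat of the next rank, share their
  intersection; different maximal singular subspaces through \<open>W\<close> are linked by chains with
  consecutive members meeting in a hyperplane (\<open>maximal_connected\<close>). The descent starts at
  \<open>m = n - t \<le> n - 2\<close>, where \<open>t \<ge> 2\<close> is used again, and ends at rank 1 with a permutation of
  the points. It preserves lines, as these are the flats of rank 2, and induces \<open>f\<close>.

  The dimension theory of singular subspaces is derived from the Veblen-Young axiom.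
\<close>

section \<open>Subspaces, spans and perps\<close>

lemma subspaceD:
  "subspace P L S \<Longrightarrow> x \<in> S \<Longrightarrow> y \<in> S \<Longrightarrow> x \<noteq> y \<Longrightarrow> l \<in> L \<Longrightarrow> x \<in> l \<Longrightarrow> y \<in> l \<Longrightarrow> l \<subseteq> S"
  unfolding subspace_def by blast

lemma subspace_Int:
  assumes "subspace P L S" "subspace P L T"
  shows "subspace P L (S \<inter> T)"
  unfolding subspace_def[of P L "S \<inter> T"]
proof (intro conjI ballI impI)
  show "S \<inter> T \<subseteq> P" using assms(1) unfolding subspace_def by auto
  fix x y l assume "x \<in> S \<inter> T" "y \<in> S \<inter> T" "l \<in> L" "x \<noteq> y \<and> x \<in> l \<and> y \<in> l"
  then show "l \<subseteq> S \<inter> T"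
    using subspaceD[OF assms(1), of x y l] subspaceD[OF assms(2), of x y l] by simp
qed

lemma span_least: "subspace P L S \<Longrightarrow> X \<subseteq> S \<Longrightarrow> span P L X \<subseteq> S"
  unfolding span_def by blast

lemma span_superset: "X \<subseteq> span P L X"
  unfolding span_def by blast

lemma span_mono: "X \<subseteq> Y \<Longrightarrow> span P L X \<subseteq> span P L Y"
  unfolding span_def by blast

lemma span_of_subspace: "subspace P L S \<Longrightarrow> span P L S = S"
  by (meson span_least span_superset subset_antisym subset_refl)

lemma span_idem: "span P L (span P L X) = span P L X"
  unfolding span_def by blast

lemma span_Un_span [simp]:
  "span P L (span P L X \<union> Y) = span P L (X \<union> Y)" "span P L (X \<union> span P L Y) = span P L (X \<union> Y)"
  unfolding span_def by blast+

lemma span_insert_span [simp]: "span P L (insert x (span P L Y)) = span P L (insert x Y)"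
  using span_Un_span(2)[of P L "{x}" Y] by simp

lemma span_insert_redundant: "x \<in> span P L X \<Longrightarrow> span P L (insert x X) = span P L X"
  by (metis insert_absorb span_idem span_insert_span)

context polar_space
begin

abbreviation "sing \<equiv> singular_subspace P L"
abbreviation "cl \<equiv> span P L"
abbreviation "orth \<equiv> perp P L"
abbreviation "Max_sing \<equiv> {M. maximal_singular P L M}"

lemma subspace_carrier: "subspace P L P"
  using line_proper unfolding subspace_def by blast

lemma subspace_span: "X \<subseteq> P \<Longrightarrow> subspace P L (cl X)"
proof -
  assume "X \<subseteq> P"
  then have "cl X \<subseteq> P"
    by (rule span_least[OF subspace_carrier])
  then show ?thesis
    unfolding subspace_def span_def by blast
qed

lemma collinear_sym: "collinear P L x y \<Longrightarrow> collinear P L y x"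
  unfolding collinear_def by blast

lemma collinear_refl: "x \<in> P \<Longrightarrow> collinear P L x x"
  unfolding collinear_def by blast

lemma sing_subspace: "sing S \<Longrightarrow> subspace P L S"
  unfolding singular_subspace_def by blast

lemma sing_carrier: "sing S \<Longrightarrow> S \<subseteq> P"
  unfolding singular_subspace_def subspace_def by blast

lemma sing_collinear: "sing S \<Longrightarrow> x \<in> S \<Longrightarrow> y \<in> S \<Longrightarrow> collinear P L x y"
  unfolding singular_subspace_def by blast

lemma sing_subset: "sing S \<Longrightarrow> subspace P L T \<Longrightarrow> T \<subseteq> S \<Longrightarrow> sing T"
  unfolding singular_subspace_def by blast

lemma sing_Int: "sing S \<Longrightarrow> subspace P L T \<Longrightarrow> sing (S \<inter> T)"
  by (meson Int_lower1 sing_subset sing_subspace subspace_Int)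

lemma sing_span_in: "sing S \<Longrightarrow> X \<subseteq> S \<Longrightarrow> sing (cl X)"
  by (meson sing_carrier sing_subset sing_subspace span_least subset_trans subspace_span)

lemma sing_empty: "sing {}"
  unfolding singular_subspace_def subspace_def by blast

lemma Max_sing_sing: "M \<in> Max_sing \<Longrightarrow> sing M"
  unfolding maximal_singular_def by blast

lemma Max_sing_eq: "M \<in> Max_sing \<Longrightarrow> sing S \<Longrightarrow> M \<subseteq> S \<Longrightarrow> S = M"
  unfolding maximal_singular_def by blast

text \<open>
The one-or-all axiom at work: a line with two points collinear to a given point
consists of points collinear to it.
\<close>

lemma subspace_perp: "subspace P L (orth X)"
  unfolding subspace_def
proof (intro conjI ballI impI subsetI)
  fix x y l z
  assume xy: "x \<in> orth X" "y \<in> orth X" and l: "l \<in> L" "x \<noteq> y \<and> x \<in> l \<and> y \<in> l" and z: "z \<in> l"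
  have zP: "z \<in> P" using l(1) z line_proper by blast
  have "collinear P L z p" if p: "p \<in> X" for p
  proof -
    have px: "collinear P L p x" "collinear P L p y"
      using xy p collinear_sym unfolding perp_def by blast+
    then have "p \<in> P" unfolding collinear_def by blast
    from P3[OF this l(1)] have "collinear P L p z"
      using px l(2) z by blast
    then show ?thesis by (rule collinear_sym)
  qed
  then show "z \<in> orth X" using zP unfolding perp_def by blast
qed (auto simp: perp_def)

lemma perp_antimono: "X \<subseteq> Y \<Longrightarrow> orth Y \<subseteq> orth X"
  unfolding perp_def by blast

lemma perp_carrier: "orth X \<subseteq> P"
  unfolding perp_def by blast

lemma subset_perp_sym: "X \<subseteq> orth Y \<Longrightarrow> Y \<subseteq> P \<Longrightarrow> Y \<subseteq> orth X"
  unfolding perp_def using collinear_sym by blast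

lemma perp_span: "X \<subseteq> P \<Longrightarrow> orth (cl X) = orth X"
proof (rule antisym[OF perp_antimono[OF span_superset]])
  assume X: "X \<subseteq> P"
  have "X \<subseteq> orth (orth X)"
    by (rule subset_perp_sym[OF subset_refl X])
  then have "cl X \<subseteq> orth (orth X)"
    by (rule span_least[OF subspace_perp])
  then show "orth X \<subseteq> orth (cl X)"
    by (rule subset_perp_sym[OF _ perp_carrier])
qed

lemma sing_iff_perp: "sing S \<longleftrightarrow> subspace P L S \<and> S \<subseteq> orth S"
  unfolding singular_subspace_def perp_def subspace_def by blast

lemma sing_span:
  assumes X: "X \<subseteq> orth X"
  shows "sing (cl X)"
proof -
  have XP: "X \<subseteq> P" using X perp_carrier by blast
  have "cl X \<subseteq> orth X"
    by (rule span_least[OF subspace_perp X])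
  then show ?thesis
    unfolding sing_iff_perp perp_span[OF XP] using subspace_span[OF XP] by blast
qed

lemma sing_span_Un:
  assumes "sing U" "sing V" "V \<subseteq> orth U"
  shows "sing (cl (U \<union> V))"
proof (rule sing_span)
  have "U \<subseteq> orth V" by (rule subset_perp_sym[OF assms(3) sing_carrier[OF assms(1)]])
  then show "U \<union> V \<subseteq> orth (U \<union> V)"
    using assms unfolding sing_iff_perp perp_def by blast
qed

lemma sing_point: "x \<in> P \<Longrightarrow> sing {x}"
  unfolding singular_subspace_def subspace_def using collinear_refl by blast

lemma sing_span_insert:
  assumes "sing U" "x \<in> orth U"
  shows "sing (cl (insert x U))"
  using sing_span_Un[OF assms(1) sing_point, of x] assms perp_carrier by fastforce

lemma chain_Union_mem:
  assumes "subset.chain {S. sing S} C" "C \<noteq> {}"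
  shows "\<Union>C \<in> C"
  using assms P4[OF assms(1)] Union_in_chain[of C "{S. sing S}"] by (auto simp: subset_chain_def)

text \<open>
Finiteness of chains makes Zorn's lemma work for every property of singular
subspaces, not only for those closed under unions of chains.
\<close>

lemma sing_maximal_with:
  assumes Q: "\<And>S. Q S \<Longrightarrow> sing S" and "Q S0"
  shows "\<exists>M. Q M \<and> (\<forall>S. Q S \<longrightarrow> M \<subseteq> S \<longrightarrow> S = M)"
proof -
  have "\<exists>M\<in>Collect Q. \<forall>S\<in>Collect Q. M \<subseteq> S \<longrightarrow> S = M"
  proof (rule subset_Zorn_nonempty)
    show "Collect Q \<noteq> {}" using assms(2) by blast
    fix C assume C: "C \<noteq> {}" "subset.chain (Collect Q) C"
    then have "subset.chain {S. sing S} C"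
      using Q unfolding subset_chain_def by blast
    from chain_Union_mem[OF this C(1)] show "\<Union>C \<in> Collect Q"
      using C(2) unfolding subset_chain_def by blast
  qed
  then show ?thesis by simp
qed

lemma sing_in_Max_sing:
  assumes "sing S"
  obtains M where "M \<in> Max_sing" "S \<subseteq> M"
proof -
  have "\<exists>M. (sing M \<and> S \<subseteq> M) \<and> (\<forall>T. sing T \<and> S \<subseteq> T \<longrightarrow> M \<subseteq> T \<longrightarrow> T = M)"
    by (rule sing_maximal_with[of _ S]) (use assms in auto)
  then obtain M where "sing M" "S \<subseteq> M" "\<forall>T. sing T \<and> S \<subseteq> T \<longrightarrow> M \<subseteq> T \<longrightarrow> T = M"
    by auto
  then have "M \<in> Max_sing" "S \<subseteq> M"
    unfolding maximal_singular_def by auto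
  then show thesis by (rule that)
qed

text \<open>
A maximal finitely generated subspace of \<open>S\<close> cannot miss a point of \<open>S\<close>, because that
point could be added to the generators.
\<close>

lemma sing_finitely_generated:
  assumes "sing S"
  obtains B where "finite B" "B \<subseteq> S" "cl B = S"
proof -
  let ?Q = "\<lambda>T. \<exists>B. finite B \<and> B \<subseteq> S \<and> cl B = T"
  have "\<exists>M. ?Q M \<and> (\<forall>T. ?Q T \<longrightarrow> M \<subseteq> T \<longrightarrow> T = M)"
  proof (rule sing_maximal_with[of ?Q "cl {}"])
    show "sing T" if "?Q T" for T
      using that sing_span_in[OF assms] by auto
    show "?Q (cl {})" by auto
  qed
  then obtain M where "?Q M" and mx: "\<And>T. ?Q T \<Longrightarrow> M \<subseteq> T \<Longrightarrow> T = M"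
    by auto
  then obtain B where B: "finite B" "B \<subseteq> S" "cl B = M" by auto
  have "S \<subseteq> M"
  proof
    fix x assume x: "x \<in> S"
    have "cl (insert x B) = M"
    proof (rule mx)
      show "?Q (cl (insert x B))"
        by (rule exI[of _ "insert x B"]) (use B x in simp)
      show "M \<subseteq> cl (insert x B)"
        unfolding B(3)[symmetric] by (rule span_mono) auto
    qed
    moreover have "x \<in> cl (insert x B)" by (rule subsetD[OF span_superset]) simp
    ultimately show "x \<in> M" by simp
  qed
  moreover have "M \<subseteq> S" using span_least[OF sing_subspace[OF assms] B(2)] B(3) by simp
  ultimately show thesis using that B by simp
qed

section \<open>Lines as spans of two points\<close>

lemma span_line:
  assumes "l \<in> L" "x \<in> l" "y \<in> l" "x \<noteq> y"
  shows "cl {x, y} = l"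
proof
  have "m = l" if "m \<in> L" "u \<in> l" "v \<in> l" "u \<noteq> v" "u \<in> m" "v \<in> m" for u v m
    using line_unique[OF that(4,1) assms(1)] that by blast
  then have "subspace P L l"
    unfolding subspace_def using line_proper[OF assms(1)] by blast
  then show "cl {x, y} \<subseteq> l" using assms by (intro span_least) auto
  have "l \<subseteq> S" if "subspace P L S" "{x, y} \<subseteq> S" for S
    using subspaceD[OF that(1) _ _ assms(4,1-3)] that(2) by blast
  then show "l \<subseteq> cl {x, y}" unfolding span_def by blast
qed

lemma span_point: "x \<in> P \<Longrightarrow> cl {x} = {x}"
  by (rule span_of_subspace[OF sing_subspace[OF sing_point]])

lemma sing_line_through:
  assumes "sing S" "x \<in> S" "y \<in> S" "x \<noteq> y"
  shows "cl {x, y} \<in> L"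
  using sing_collinear[OF assms(1-3)] assms(4) span_line unfolding collinear_def by metis

lemma span_pair_in: "sing S \<Longrightarrow> x \<in> S \<Longrightarrow> y \<in> S \<Longrightarrow> cl {x, y} \<subseteq> S"
  by (rule span_least[OF sing_subspace]) auto

lemma span_pair_eq:
  assumes "sing S" "x \<in> S" "y \<in> S" "z \<in> cl {x, y}" "w \<in> cl {x, y}" "z \<noteq> w"
  shows "cl {z, w} = cl {x, y}"
proof -
  have "x \<noteq> y"
    using assms span_point[of x] sing_carrier[OF assms(1)] by auto
  from sing_line_through[OF assms(1-3) this] show ?thesis
    using assms by (intro span_line) auto
qed

lemma in_span_pair: "x \<in> cl {x, y}" "y \<in> cl {x, y}"
  using span_superset[of "{x, y}" P L] by auto

lemma span_pair_exchange:
  assumes "sing S" "x \<in> S" "y \<in> S" "z \<in> cl {x, y}" "z \<noteq> x"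
  shows "y \<in> cl {x, z}"
  using span_pair_eq[OF assms(1-3) in_span_pair(1) assms(4)] assms(5) in_span_pair by metis

end

context polar_space_of_rank
begin

text \<open>
The Veblen-Young axiom with the lines given by pairs of points. Allowing these pairs to
be degenerate, as long as the lines in the conclusion are not, removes most case
distinctions later.
\<close>

lemma pasch:
  assumes S: "sing S" "a \<in> S" "b \<in> S" "c \<in> S" "d \<in> S" and ne: "a \<noteq> c" "b \<noteq> d"
    and p: "p \<in> cl {a, b}" "p \<in> cl {c, d}"
  obtains q where "q \<in> cl {a, c}" "q \<in> cl {b, d}"
proof (cases "distinct [a, b, c, d]")
  case True
  obtain M where M: "M \<in> Max_sing" "S \<subseteq> M" using sing_in_Max_sing[OF S(1)] by blast
  then interpret M: projective_space M "{l \<in> L. l \<subseteq> M}" using maximal_projective by blast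
  have M': "sing M" "a \<in> M" "b \<in> M" "c \<in> M" "d \<in> M" using M S Max_sing_sing by auto
  have "cl {a, c} \<inter> cl {b, d} \<noteq> {}"
  proof (rule M.veblen_young[OF True])
    show "cl {a, b} \<in> {l \<in> L. l \<subseteq> M}" "cl {c, d} \<in> {l \<in> L. l \<subseteq> M}"
      "cl {a, c} \<in> {l \<in> L. l \<subseteq> M}" "cl {b, d} \<in> {l \<in> L. l \<subseteq> M}"
      using True M' sing_line_through span_pair_in by auto
  qed (use p in_span_pair in auto)
  then show thesis using that by blast
next
  case False
  consider "a = b" | "a = d" | "b = c" | "c = d" using False ne by auto
  then show thesis
  proof cases
    case 1 then show thesis using that[of a] in_span_pair by metis
  next
    case 2 then show thesis using that[of a] in_span_pair by metis
  next
    case 3 then show thesis using that[of b] in_span_pair by metis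
  next
    case 4 then show thesis using that[of c] in_span_pair by metis
  qed
qed

lemma span_empty: "cl {} = {}"
  by (rule span_of_subspace[OF sing_subspace[OF sing_empty]])

lemma in_perp: "sing S \<Longrightarrow> x \<in> S \<Longrightarrow> U \<subseteq> S \<Longrightarrow> x \<in> orth U"
  unfolding sing_iff_perp using perp_antimono by blast

lemma span_in: "sing S \<Longrightarrow> X \<subseteq> S \<Longrightarrow> cl X \<subseteq> S"
  by (rule span_least[OF sing_subspace])

lemma sing_span_self: "sing S \<Longrightarrow> cl S = S"
  by (rule span_of_subspace[OF sing_subspace])

lemma in_span: "x \<in> X \<Longrightarrow> x \<in> cl X"
  by (rule subsetD[OF span_superset])

section \<open>Joins of singular subspaces\<close>

text \<open>
The union of the lines joining \<open>x\<close> to the points of \<open>U\<close> is closed under joining points: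
project the line \<open>y1 y2\<close> from \<open>x\<close> into \<open>U\<close>.
\<close>

lemma cone_line_closed:
  assumes S: "sing S" "x \<in> S" "U \<subseteq> S" and U: "sing U" "x \<notin> U"
    and u: "u1 \<in> U" "u2 \<in> U" and y: "y1 \<in> cl {x, u1}" "y2 \<in> cl {x, u2}"
    and z: "z \<in> cl {y1, y2}"
  shows "\<exists>u\<in>U. z \<in> cl {x, u}"
proof -
  have uS: "u1 \<in> S" "u2 \<in> S" using S u by auto
  have yS: "y1 \<in> S" "y2 \<in> S" using span_pair_in[OF S(1,2)] uS y by blast+
  have zS: "z \<in> S" using span_pair_in[OF S(1) yS] z by blast
  have two: "cl {a, b} \<subseteq> cl {x, v}" if "a \<in> cl {x, v}" "b \<in> cl {x, v}" "v \<in> U" for a b v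
    by (rule span_least) (use that S subspace_span sing_carrier in \<open>auto intro!: subspace_span\<close>)
  show ?thesis
  proof (cases "y1 = y2 \<or> z = x \<or> u1 = u2 \<or> y1 = x \<or> y2 = x")
    case True
    then show ?thesis
      using two[OF y(1) _ u(1), of y2] two[OF _ y(2) u(2), of y1] two[OF y(1) y(1) u(1)]
        in_span_pair[of x] y z u by blast
  next
    case False
    \<comment> \<open>The line \<open>u1 u2\<close> meets two sides of the triangle \<open>x y1 y2\<close>, so it meets the third.\<close>
    have "\<exists>w. w \<in> cl {u1, u2} \<and> w \<in> cl {y1, y2}"
    proof (cases "y1 = u1 \<or> y2 = u2")
      case True
      then show ?thesis using in_span_pair by metis
    next
      case ne: False
      have "x \<in> cl {u1, y1}" "x \<in> cl {u2, y2}"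
        using span_pair_eq[OF S(1,2) uS(1) in_span_pair(2) y(1)] 
          span_pair_eq[OF S(1,2) uS(2) in_span_pair(2) y(2)] ne in_span_pair by metis+
      then show ?thesis
        using pasch[OF S(1) uS(1) yS(1) uS(2) yS(2)] False by metis
    qed
    then obtain w where w: "w \<in> cl {u1, u2}" "w \<in> cl {y1, y2}" by blast
    have wU: "w \<in> U" using span_pair_in[OF U(1) u] w by blast
    show ?thesis
    proof (cases "z = w")
      case True
      then show ?thesis using wU in_span_pair by metis
    next
      case zw: False
      have eq: "cl {z, w} = cl {y1, y2}"
        by (rule span_pair_eq[OF S(1) yS z w(2) zw])
      \<comment> \<open>At least one of \<open>u1\<close>, \<open>u2\<close> differs from \<open>w\<close>; the line \<open>x z\<close> meets the line joining that one to \<open>w\<close>.\<close>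
      obtain v yv where v: "v \<in> U" "v \<noteq> w" "yv \<in> cl {x, v}" "yv \<in> cl {z, w}"
        using False u y eq in_span_pair by metis
      obtain q where q: "q \<in> cl {x, z}" "q \<in> cl {v, w}"
        using pasch[OF S(1,2) _ zS _ _ v(2,3,4)] v(1) wU S(3) False by blast
      have qU: "q \<in> U" using span_pair_in[OF U(1) v(1) wU] q by blast
      then have "q \<noteq> x" using U by blast
      from span_pair_exchange[OF S(1,2) zS q(1) this] qU show ?thesis by blast
    qed
  qed
qed

lemma cone:
  assumes U: "sing U" "x \<in> orth U" "x \<notin> U" "U \<noteq> {}" and z: "z \<in> cl (insert x U)"
  shows "\<exists>u\<in>U. z \<in> cl {x, u}"
proof -
  let ?J = "\<Union>u\<in>U. cl {x, u}"
  have S: "sing (cl (insert x U))" by (rule sing_span_insert[OF U(1,2)])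
  have xS: "x \<in> cl (insert x U)" "U \<subseteq> cl (insert x U)" using in_span by blast+
  have "subspace P L ?J"
    unfolding subspace_def
  proof (intro conjI ballI impI subsetI)
    fix z assume "z \<in> ?J"
    then show "z \<in> P" using span_pair_in[OF S xS(1)] xS(2) sing_carrier[OF S] by blast
  next
    fix y1 y2 l z
    assume y: "y1 \<in> ?J" "y2 \<in> ?J" and l: "l \<in> L" "y1 \<noteq> y2 \<and> y1 \<in> l \<and> y2 \<in> l" and z: "z \<in> l"
    then have "z \<in> cl {y1, y2}" using span_line[of l y1 y2] by simp
    moreover obtain u1 u2 where "u1 \<in> U" "y1 \<in> cl {x, u1}" "u2 \<in> U" "y2 \<in> cl {x, u2}"
      using y by auto
    ultimately have "\<exists>u\<in>U. z \<in> cl {x, u}"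
      by (intro cone_line_closed[OF S xS U(1,3), of u1 u2 y1 y2])
    then show "z \<in> ?J" by simp
  qed
  moreover have "insert x U \<subseteq> ?J" using in_span_pair U(4) by blast
  ultimately have "cl (insert x U) \<subseteq> ?J" by (rule span_least)
  then show ?thesis using z by blast
qed

lemma exchange:
  assumes U: "sing U" "x \<in> orth U" and y: "y \<in> cl (insert x U)" "y \<notin> U"
  shows "cl (insert y U) = cl (insert x U)" "x \<in> cl (insert y U)"
proof -
  have S: "sing (cl (insert x U))" by (rule sing_span_insert[OF U(1,2)])
  have xS: "x \<in> cl (insert x U)" "U \<subseteq> cl (insert x U)" using in_span by blast+
  have nx: "x \<notin> U" using y sing_span_self[OF U(1)] by (metis insert_absorb)
  show x: "x \<in> cl (insert y U)"
  proof (cases "U = {}")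
    case True
    then show ?thesis using y U span_point perp_carrier in_span by fastforce
  next
    case False
    obtain u where u: "u \<in> U" "y \<in> cl {x, u}" using cone[OF U nx False y(1)] by blast
    then have "x \<in> cl {u, y}"
      using span_pair_exchange[OF S _ xS(1), of u y] xS y(2) by (metis insert_commute subsetD)
    moreover have "cl {u, y} \<subseteq> cl (insert y U)" by (rule span_mono) (use u in auto)
    ultimately show ?thesis by blast
  qed
  have "cl (insert x U) \<subseteq> cl (insert y U)"
  proof (rule span_least)
    have "insert y U \<subseteq> P" using S sing_carrier y xS by blast
    then show "subspace P L (cl (insert y U))" by (rule subspace_span)
    show "insert x U \<subseteq> cl (insert y U)" using x in_span by blast
  qed
  moreover have "cl (insert y U) \<subseteq> cl (insert x U)"
    by (rule span_in[OF S]) (use y xS in auto)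
  ultimately show "cl (insert y U) = cl (insert x U)" by blast
qed

text \<open>
Induction on \<open>B\<close>: adding a generator \<open>b\<close> gives a point in a plane spanned by some \<open>b\<close>, \<open>u\<close>, \<open>v\<close>, and
this plane is also the cone with apex \<open>u\<close> over the line \<open>b v\<close>.
\<close>

lemma join_finite:
  assumes S: "sing S" "U \<subseteq> S" and U: "sing U" "U \<noteq> {}"
    and B: "finite B" "B \<noteq> {}" "B \<subseteq> S" and z: "z \<in> cl (U \<union> B)"
  shows "\<exists>u\<in>U. \<exists>v\<in>cl B. z \<in> cl {u, v}"
  using B z
proof (induction B arbitrary: z rule: finite_ne_induct)
  case (singleton b)
  have "b \<in> cl {b}" by (rule in_span) simp
  show ?case
  proof (cases "b \<in> U")
    case True
    then have "U \<union> {b} = U" by blast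
    then have "z \<in> U" using singleton sing_span_self[OF U(1)] by simp
    then show ?thesis using \<open>b \<in> cl {b}\<close> in_span_pair by metis
  next
    case False
    have "z \<in> cl (insert b U)" using singleton by simp
    moreover have "b \<in> orth U" using in_perp[OF S(1) _ S(2)] singleton by simp
    ultimately obtain u where "u \<in> U" "z \<in> cl {b, u}" using cone[OF U(1) _ False U(2)] by blast
    then show ?thesis using \<open>b \<in> cl {b}\<close> by (metis insert_commute)
  qed
next
  case (insert b B)
  let ?W = "cl (U \<union> B)"
  have sub: "U \<union> B \<subseteq> S" "b \<in> S" "B \<subseteq> S" using insert S by auto
  have W: "sing ?W" "?W \<subseteq> S" using sing_span_in[OF S(1)] span_in[OF S(1)] sub by blast+
  have BB: "cl B \<subseteq> cl (insert b B)" by (rule span_mono) auto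
  have z: "z \<in> cl (insert b ?W)" using insert.prems by simp
  show ?case
  proof (cases "b \<in> ?W")
    case True
    then have "z \<in> ?W" using z sing_span_self[OF W(1)] by (simp add: insert_absorb)
    then show ?thesis using insert.IH sub(3) BB by blast
  next
    case False
    have "?W \<noteq> {}" using U(2) in_span by blast
    then obtain w where w: "w \<in> ?W" "z \<in> cl {b, w}"
      using cone[OF W(1) in_perp[OF S(1) sub(2) W(2)] False _ z] by blast
    obtain u v where uv: "u \<in> U" "v \<in> cl B" "w \<in> cl {u, v}"
      using insert.IH[OF sub(3) w(1)] by blast
    have vS: "v \<in> S" "u \<in> S" using uv span_in[OF S(1) sub(3)] S by auto
    let ?E = "cl {b, v}"
    have E: "sing ?E" "?E \<subseteq> S"
      using sing_span_in[OF S(1), of "{b, v}"] span_in[OF S(1), of "{b, v}"] vS sub by auto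
    have "b \<in> cl (insert b B)" "v \<in> cl (insert b B)" using uv BB in_span[of b] by auto
    moreover have sB: "sing (cl (insert b B))" by (rule sing_span_in[OF S(1)]) (use sub in auto)
    ultimately have EB: "?E \<subseteq> cl (insert b B)" using span_pair_in by blast
    have sE: "sing (cl (insert u ?E))" by (rule sing_span_in[OF S(1)]) (use E vS in auto)
    have m: "u \<in> cl (insert u ?E)" "b \<in> cl (insert u ?E)" "v \<in> cl (insert u ?E)"
      using in_span[of _ "insert u ?E"] in_span_pair[of b v] in_span_pair(2)[where x = b and y = v]
      by blast+
    have "w \<in> cl (insert u ?E)" using span_pair_in[OF sE m(1,3)] uv by blast
    then have zE: "z \<in> cl (insert u ?E)" using span_pair_in[OF sE m(2)] w by blast
    show ?thesis
    proof (cases "u \<in> ?E")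
      case True
      then have "z \<in> ?E" using zE sing_span_self[OF E(1)] by (simp add: insert_absorb)
      then show ?thesis using EB U(2) in_span_pair by blast
    next
      case False
      have "?E \<noteq> {}" using in_span_pair by blast
      then obtain y where "y \<in> ?E" "z \<in> cl {u, y}"
        using cone[OF E(1) in_perp[OF S(1) vS(2) E(2)] False _ zE] by blast
      then show ?thesis using EB uv by blast
    qed
  qed
qed

section \<open>Rank\<close>

text \<open>
The rank is the projective dimension plus one; as a natural number starting at 0 for
the empty subspace it makes the dimension formulas and inductions free of the value
\<open>-1\<close>.
\<close>

definition rk :: "'a set \<Rightarrow> nat" where
  "rk S = (LEAST m. \<exists>B\<subseteq>S. finite B \<and> card B = m \<and> cl B = S)"

lemma pdim_eq_rk: "pdim P L S = int (rk S) - 1"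
  unfolding pdim_def rk_def ..

lemma rk_le_card: "finite B \<Longrightarrow> cl B = S \<Longrightarrow> rk S \<le> card B"
  unfolding rk_def using span_superset[of B P L] by (intro Least_le) blast

lemma rk_witness:
  assumes "sing S"
  obtains B where "finite B" "B \<subseteq> S" "card B = rk S" "cl B = S"
proof -
  obtain B where "finite B" "B \<subseteq> S" "cl B = S" using sing_finitely_generated[OF assms] .
  then have "\<exists>m. \<exists>B\<subseteq>S. finite B \<and> card B = m \<and> cl B = S" by auto
  then have "\<exists>B\<subseteq>S. finite B \<and> card B = rk S \<and> cl B = S"
    unfolding rk_def by (rule LeastI_ex)
  then show thesis using that by auto
qed

lemma rk_empty [simp]: "rk {} = 0"
  using rk_le_card[of "{}"] span_empty by auto

text \<open>
The substance is that the hyperplane \<open>U\<close> of the span \<open>V\<close> of \<open>U\<close> and \<open>x\<close> needs fewer generators than \<open>V\<close>. Given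
generators of \<open>V\<close>, choose one, \<open>b\<close>, outside \<open>U\<close> and project the others from \<open>b\<close> into \<open>U\<close>;
the projections generate \<open>U\<close>. This replaces the usual exchange argument for bases.
\<close>

lemma rk_insert:
  assumes U: "sing U" "x \<in> orth U" "x \<notin> U"
  shows "rk (cl (insert x U)) = Suc (rk U)"
proof (rule antisym)
  let ?V = "cl (insert x U)"
  obtain A where A: "finite A" "A \<subseteq> U" "card A = rk U" "cl A = U" using rk_witness[OF U(1)] .
  have "cl (insert x A) = ?V" using span_insert_span[of P L x A] A(4) by simp
  then have "rk ?V \<le> card (insert x A)" using A(1) by (intro rk_le_card) auto
  also have "\<dots> \<le> Suc (rk U)" using A(1,3) by (simp add: card_insert_if)
  finally show "rk ?V \<le> Suc (rk U)" .
  have V: "sing ?V" by (rule sing_span_insert[OF U(1,2)])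
  obtain B where B: "finite B" "B \<subseteq> ?V" "card B = rk ?V" "cl B = ?V" using rk_witness[OF V] .
  have "\<not> B \<subseteq> U"
  proof
    assume "B \<subseteq> U"
    then have "cl B \<subseteq> U" by (rule span_in[OF U(1)])
    moreover have "x \<in> ?V" by (rule in_span) simp
    ultimately show False using B(4) U(3) by blast
  qed
  then obtain b where b: "b \<in> B" "b \<notin> U" by blast
  have bV: "b \<in> ?V" using b B by blast
  have Vb: "cl (insert b U) = ?V" by (rule exchange(1)[OF U(1,2) bV b(2)])
  have bU: "b \<in> orth U" using in_perp[OF V bV, of U] in_span by blast
  show "Suc (rk U) \<le> rk ?V"
  proof (cases "U = {}")
    case True
    have "card B > 0" using B(1) b(1) by (auto simp: card_gt_0_iff)
    then show ?thesis using B(3) True by simp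
  next
    case False
    have "\<exists>u\<in>U. c \<in> cl {b, u}" if "c \<in> B" for c
      using cone[OF U(1) bU b(2) False] Vb B that by blast
    then obtain f where f: "\<And>c. c \<in> B \<Longrightarrow> f c \<in> U" "\<And>c. c \<in> B \<Longrightarrow> c \<in> cl {b, f c}" by metis
    let ?B = "f ` (B - {b})"
    let ?A = "cl ?B"
    have BU: "?B \<subseteq> U" using f by blast
    have AU: "?A \<subseteq> U" "sing ?A" using span_in[OF U(1) BU] sing_span_in[OF U(1) BU] by blast+
    have bA: "b \<in> orth ?A" using bU AU perp_antimono by blast
    have sA: "sing (cl (insert b ?A))" by (rule sing_span_insert[OF AU(2) bA])
    have "B \<subseteq> cl (insert b ?A)"
    proof
      fix c assume c: "c \<in> B"
      have "b \<in> cl (insert b ?A)" by (rule in_span) simp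
      moreover have "f c \<in> cl (insert b ?A)" if "c \<noteq> b"
        by (rule in_span) (use that c in \<open>auto intro!: in_span\<close>)
      ultimately show "c \<in> cl (insert b ?A)" using span_pair_in[OF sA, of b "f c"] f(2)[OF c] by blast
    qed
    then have VA: "?V \<subseteq> cl (insert b ?A)" using span_in[OF sA] B(4) by blast
    have "U \<subseteq> ?A"
    proof
      fix z assume z: "z \<in> U"
      then have zA: "z \<in> cl (insert b ?A)" using VA in_span by blast
      have "b \<notin> ?A" using AU b by blast
      show "z \<in> ?A"
      proof (cases "?A = {}")
        case True
        then have "z \<in> {b}" using zA span_point[of b] bA perp_carrier by auto
        then show ?thesis using z b by blast
      next
        case False
        obtain a where a: "a \<in> ?A" "z \<in> cl {b, a}"
          using cone[OF AU(2) bA \<open>b \<notin> ?A\<close> False zA] by blast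
        show ?thesis
        proof (cases "z = a")
          case False
          have "a \<in> ?V" using a AU in_span by blast
          then have "b \<in> cl {a, z}"
            using span_pair_exchange[OF V _ bV, of a z] a False by (metis insert_commute)
          then show ?thesis using span_pair_in[OF U(1), of a z] a AU z b by blast
        qed (use a in simp)
      qed
    qed
    then have "cl ?B = U" using AU by blast
    then have "rk U \<le> card ?B" using B(1) by (intro rk_le_card) auto
    also have "\<dots> \<le> card (B - {b})" using B(1) by (intro card_image_le) auto
    also have "\<dots> < card B" using B(1) b(1) by (rule card_Diff1_less)
    finally show ?thesis using B(3) by simp
  qed
qed

lemma rk_insert_in:
  assumes "sing S" "U \<subseteq> S" "sing U" "x \<in> S" "x \<notin> U"
  shows "rk (cl (insert x U)) = Suc (rk U)"
  using rk_insert[OF assms(3) in_perp[OF assms(1,4,2)] assms(5)] .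

lemma rk_mono:
  assumes V: "sing V" and U: "sing U" "U \<subseteq> V"
  shows "rk U \<le> rk V"
proof -
  obtain B where B: "finite B" "B \<subseteq> V" "cl B = V" using sing_finitely_generated[OF V] .
  have "rk U \<le> rk (cl (U \<union> C))" if "finite C" "C \<subseteq> V" for C
    using that
  proof (induction C rule: finite_induct)
    case empty
    then show ?case using sing_span_self[OF U(1)] by simp
  next
    case (insert c C)
    have W: "cl (U \<union> C) \<subseteq> V" "sing (cl (U \<union> C))"
      using span_in[OF V, of "U \<union> C"] sing_span_in[OF V, of "U \<union> C"] insert U by auto
    have eq: "cl (U \<union> insert c C) = cl (insert c (cl (U \<union> C)))" by simp
    show ?case
    proof (cases "c \<in> cl (U \<union> C)")
      case True
      then show ?thesis
        unfolding eq using insert sing_span_self[OF W(2)] by (simp add: insert_absorb)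
    next
      case False
      have "rk (cl (U \<union> insert c C)) = Suc (rk (cl (U \<union> C)))"
        unfolding eq by (rule rk_insert_in[OF V W _ False]) (use insert in auto)
      then show ?thesis using insert by simp
    qed
  qed
  from this[OF B(1,2)] show ?thesis
    using B span_mono[of B "U \<union> B" P L] span_in[OF V, of "U \<union> B"] U(2) by (simp add: subset_antisym)
qed

lemma rk_strict_mono:
  assumes V: "sing V" and U: "sing U" "U \<subset> V"
  shows "rk U < rk V"
proof -
  obtain x where x: "x \<in> V" "x \<notin> U" using U by blast
  have "rk (cl (insert x U)) = Suc (rk U)"
    by (rule rk_insert_in[OF V _ U(1) x]) (use U in auto)
  moreover have "rk (cl (insert x U)) \<le> rk V"
    using sing_span_in[OF V, of "insert x U"] span_in[OF V, of "insert x U"] U x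
    by (intro rk_mono[OF V]) auto
  ultimately show ?thesis by simp
qed

lemma rk_eq_imp_eq: "sing V \<Longrightarrow> sing U \<Longrightarrow> U \<subseteq> V \<Longrightarrow> rk V \<le> rk U \<Longrightarrow> U = V"
  using rk_strict_mono[of V U] by force

text \<open>
A case of the modular law of the lattice of singular subspaces.
\<close>

lemma insert_Int:
  assumes S: "sing S" "U \<subseteq> S" "V \<subseteq> S" and U: "sing U" "sing V" and y: "y \<in> U"
  shows "U \<inter> cl (insert y V) = cl (insert y (U \<inter> V))"
proof
  have yS: "y \<in> S" using y S by blast
  show "cl (insert y (U \<inter> V)) \<subseteq> U \<inter> cl (insert y V)"
    using span_in[OF U(1), of "insert y (U \<inter> V)"] span_mono[of "insert y (U \<inter> V)" "insert y V"] y
    by blast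
  show "U \<inter> cl (insert y V) \<subseteq> cl (insert y (U \<inter> V))"
  proof
    fix z assume z: "z \<in> U \<inter> cl (insert y V)"
    show "z \<in> cl (insert y (U \<inter> V))"
    proof (cases "y \<in> V \<or> V = {}")
      case True
      then have "z \<in> insert y (U \<inter> V)"
        using z sing_span_self[OF U(2)] span_point[of y] sing_carrier[OF S(1)] yS
        by (auto simp: insert_absorb)
      then show ?thesis by (rule in_span)
    next
      case False
      then obtain v where v: "v \<in> V" "z \<in> cl {y, v}"
        using cone[OF U(2) in_perp[OF S(1) yS S(3)]] z by blast
      show ?thesis
      proof (cases "z = y")
        case True
        then show ?thesis by (intro in_span) simp
      next
        case False
        have "v \<in> cl {y, z}" using span_pair_exchange[OF S(1) yS _ v(2) False] v S by blast
        then have "v \<in> U \<inter> V" using span_pair_in[OF U(1) y] z v by blast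
        then have "cl {y, v} \<subseteq> cl (insert y (U \<inter> V))" by (intro span_mono) auto
        then show ?thesis using v by blast
      qed
    qed
  qed
qed

text \<open>
Induction on generators of \<open>V\<close>. A new generator outside the current span of \<open>U\<close> and \<open>V\<close>
raises the rank of the span and leaves the intersection alone; one inside it comes, by
the description of joins, with a new point of the intersection.
\<close>

lemma rk_modular:
  assumes S: "sing S" "U \<subseteq> S" "V \<subseteq> S" and UV: "sing U" "sing V"
  shows "rk (cl (U \<union> V)) + rk (U \<inter> V) = rk U + rk V"
proof -
  obtain B where B: "finite B" "B \<subseteq> V" "cl B = V" using sing_finitely_generated[OF UV(2)] .
  have "rk (cl (U \<union> C)) + rk (U \<inter> cl C) = rk U + rk (cl C)" if "finite C" "C \<subseteq> S" for C
    using that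
  proof (induction C rule: finite_induct)
    case empty
    then show ?case using sing_span_self[OF UV(1)] span_empty by simp
  next
    case (insert c C)
    let ?W = "cl (U \<union> C)" and ?V = "cl C"
    have sub: "U \<union> C \<subseteq> S" "C \<subseteq> S" "c \<in> S" using insert S by auto
    have W: "sing ?W" "?W \<subseteq> S" using sing_span_in[OF S(1)] span_in[OF S(1)] sub by blast+
    have V: "sing ?V" "?V \<subseteq> S" using sing_span_in[OF S(1)] span_in[OF S(1)] sub by blast+
    have VW: "?V \<subseteq> ?W" "U \<subseteq> ?W" using span_mono[of C "U \<union> C" P L] in_span by auto
    have eqW: "cl (U \<union> insert c C) = cl (insert c ?W)" by simp
    have eqV: "cl (insert c C) = cl (insert c ?V)" by simp
    show ?case
    proof (cases "c \<in> ?V")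
      case True
      then have "c \<in> ?W" using VW by blast
      then have "cl (U \<union> insert c C) = ?W" using span_insert_redundant[of c P L "U \<union> C"] by simp
      moreover have "cl (insert c C) = ?V" using True by (rule span_insert_redundant)
      ultimately show ?thesis using insert by simp
    next
      case cV: False
      have rV: "rk (cl (insert c ?V)) = Suc (rk ?V)"
        by (rule rk_insert_in[OF S(1) V(2,1) sub(3) cV])
      show ?thesis
      proof (cases "c \<in> ?W")
        case False
        have rW: "rk (cl (insert c ?W)) = Suc (rk ?W)"
          by (rule rk_insert_in[OF S(1) W(2,1) sub(3) False])
        have "U \<inter> cl (insert c ?V) \<subseteq> ?V"
        proof (rule ccontr)
          assume "\<not> U \<inter> cl (insert c ?V) \<subseteq> ?V"
          then obtain y where y: "y \<in> U" "y \<in> cl (insert c ?V)" "y \<notin> ?V" by blast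
          have "c \<in> cl (insert y ?V)"
            by (rule exchange(2)[OF V(1) in_perp[OF S(1) sub(3) V(2)] y(2,3)])
          moreover have "cl (insert y ?V) \<subseteq> ?W"
            by (rule span_in[OF W(1)]) (use VW y in auto)
          ultimately show False using False by blast
        qed
        moreover have "?V \<subseteq> cl (insert c ?V)" using in_span by blast
        ultimately have "U \<inter> cl (insert c ?V) = U \<inter> ?V" by blast
        then show ?thesis unfolding eqW eqV using insert rV rW by simp
      next
        case True
        have cW: "cl (insert c ?W) = ?W" using True sing_span_self[OF W(1)] by (simp add: insert_absorb)
        have "\<exists>y. y \<in> U \<and> y \<in> cl (insert c ?V) \<and> y \<notin> ?V"
        proof (cases "C = {}")
          case e: True
          then have "c \<in> U" using True sing_span_self[OF UV(1)] by simp
          then show ?thesis using e span_empty in_span[of c] by auto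
        next
          case ne: False
          have "U \<noteq> {}" using True cV by auto
          then obtain u v where uv: "u \<in> U" "v \<in> ?V" "c \<in> cl {u, v}"
            using join_finite[OF S(1,2) UV(1) _ insert(1) ne sub(2) True] by blast
          have uS: "u \<in> S" "v \<in> S" using uv S V by auto
          have cv: "c \<noteq> v" using uv cV by blast
          have "u \<in> cl {v, c}"
            using span_pair_exchange[OF S(1) uS(2,1) _ cv] uv by (metis insert_commute)
          moreover have "cl {v, c} \<subseteq> cl (insert c ?V)" by (rule span_mono) (use uv in auto)
          moreover have "u \<notin> ?V" using span_pair_in[OF V(1) _ uv(2)] uv(3) cV by blast
          ultimately show ?thesis using uv by blast
        qed
        then obtain y where y: "y \<in> U" "y \<in> cl (insert c ?V)" "y \<notin> ?V" by blast
        have yS: "y \<in> S" using y S by blast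
        have "cl (insert y ?V) = cl (insert c ?V)"
          by (rule exchange(1)[OF V(1) in_perp[OF S(1) sub(3) V(2)] y(2,3)])
        moreover have "U \<inter> cl (insert y ?V) = cl (insert y (U \<inter> ?V))"
          by (rule insert_Int[OF S(1,2) V(2) UV(1) V(1) y(1)])
        moreover have "rk (cl (insert y (U \<inter> ?V))) = Suc (rk (U \<inter> ?V))"
          using y yS S by (intro rk_insert_in[OF S(1) _ sing_Int[OF UV(1) sing_subspace[OF V(1)]]]) auto
        ultimately show ?thesis unfolding eqW eqV using insert rV cW by simp
      qed
    qed
  qed
  from this[OF B(1)] show ?thesis
    using B S span_Un_span(2)[of P L U B] by simp
qed

section \<open>Intermediate flats and hyperplanes\<close>

lemma rk_between:
  assumes V: "sing V" and U: "sing U" "U \<subseteq> V" and j: "rk U \<le> j" "j \<le> rk V"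
  shows "\<exists>W. sing W \<and> U \<subseteq> W \<and> W \<subseteq> V \<and> rk W = j"
  using j
proof (induction j rule: dec_induct)
  case base
  then show ?case using U by auto
next
  case (step j)
  then obtain W where W: "sing W" "U \<subseteq> W" "W \<subseteq> V" "rk W = j" by auto
  then have "W \<noteq> V" using step by auto
  then obtain x where x: "x \<in> V" "x \<notin> W" using W by blast
  have "rk (cl (insert x W)) = Suc j" using rk_insert_in[OF V W(3,1) x] W(4) by simp
  moreover have "insert x W \<subseteq> V" using x W by blast
  then have "sing (cl (insert x W))" "cl (insert x W) \<subseteq> V"
    using sing_span_in[OF V] span_in[OF V] by blast+
  moreover have "U \<subseteq> cl (insert x W)" using W(2) in_span[of _ "insert x W"] by blast
  ultimately show ?case by (intro exI[of _ "cl (insert x W)"]) simp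
qed

lemma hyperplane_avoiding:
  assumes V: "sing V" and U: "sing U" "U \<subseteq> V" and x: "x \<in> V" "x \<notin> U"
  obtains H where "sing H" "U \<subseteq> H" "H \<subseteq> V" "x \<notin> H" "rk V = Suc (rk H)"
proof -
  let ?Q = "\<lambda>T. sing T \<and> U \<subseteq> T \<and> T \<subseteq> V \<and> x \<notin> T"
  have "\<exists>H. ?Q H \<and> (\<forall>T. ?Q T \<longrightarrow> H \<subseteq> T \<longrightarrow> T = H)"
    by (rule sing_maximal_with[of ?Q U]) (use assms in auto)
  then obtain H where H: "sing H" "U \<subseteq> H" "H \<subseteq> V" "x \<notin> H"
    and mx: "\<And>T. ?Q T \<Longrightarrow> H \<subseteq> T \<Longrightarrow> T = H" by auto
  have xH: "x \<in> orth H" by (rule in_perp[OF V x(1) H(3)])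
  have "V \<subseteq> cl (insert x H)"
  proof (rule ccontr)
    assume "\<not> V \<subseteq> cl (insert x H)"
    then obtain y where y: "y \<in> V" "y \<notin> cl (insert x H)" by blast
    let ?T = "cl (insert y H)"
    have yT: "y \<in> ?T" "H \<subseteq> ?T" using in_span by auto
    have T: "sing ?T" "?T \<subseteq> V"
      using sing_span_in[OF V, of "insert y H"] span_in[OF V, of "insert y H"] y H by auto
    have "x \<notin> ?T"
      using exchange(2)[OF H(1) in_perp[OF V y(1) H(3)] _ H(4)] y(2) by blast
    then have "?T = H" using T yT H by (intro mx) auto
    then show False using yT y in_span[of y "insert x H"] by auto
  qed
  moreover have "cl (insert x H) \<subseteq> V" by (rule span_in[OF V]) (use x H in auto)
  ultimately have "V = cl (insert x H)" by blast
  then have "rk V = Suc (rk H)" using rk_insert[OF H(1) xH H(4)] by simp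
  then show thesis using that H by blast
qed

section \<open>Avoiding proper subspaces; common supplements\<close>

lemma third_point:
  assumes "sing S" "x \<in> S" "y \<in> S" "x \<noteq> y"
  obtains z where "z \<in> cl {x, y}" "z \<noteq> x" "z \<noteq> y"
  using P1[OF sing_line_through[OF assms]] by metis

lemma line_meets_once:
  assumes "sing S" "x \<in> S" "y \<in> S" and A: "sing A" "x \<in> A" "y \<notin> A"
    and z: "z \<in> cl {x, y}" "z \<noteq> x"
  shows "z \<notin> A"
  using span_pair_exchange[OF assms(1-3) z] span_pair_in[OF A(1,2)] A(3) by blast

text \<open>
Take a point outside \<open>A\<close> and a point outside \<open>B\<close>. If the former is in \<open>B\<close> and the latter
in \<open>A\<close>, every third point of the line joining them is in neither.
\<close>

lemma avoid_two:
  assumes M: "sing M" and A: "sing A" "A \<subset> M" and B: "sing B" "B \<subset> M"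
  obtains z where "z \<in> M" "z \<notin> A" "z \<notin> B"
proof -
  obtain a b where ab: "a \<in> M" "a \<notin> A" "b \<in> M" "b \<notin> B" using A B by blast
  show thesis
  proof (cases "a \<in> B \<and> b \<in> A")
    case True
    then have "a \<noteq> b" using ab by blast
    obtain z where z: "z \<in> cl {a, b}" "z \<noteq> a" "z \<noteq> b"
      using third_point[OF M ab(1,3) \<open>a \<noteq> b\<close>] .
    have "z \<notin> A" 
      using line_meets_once[OF M ab(3,1) A(1) _ ab(2) _ z(3)] True z(1) by (simp add: insert_commute)
    moreover have "z \<notin> B" using line_meets_once[OF M ab(1,3) B(1) _ ab(4) z(1,2)] True by blast
    moreover have "z \<in> M" using span_pair_in[OF M ab(1,3)] z by blast
    ultimately show thesis using that by blast
  qed (use that ab in blast)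
qed

text \<open>
Over the field with two elements three hyperplanes through a common subspace of
codimension two cover the whole space; the point \<open>y\<close> rules this out. On a line joining
\<open>y\<close> to a point \<open>b\<close> outside \<open>B\<close> and \<open>C\<close>, every third point is outside \<open>B\<close> and \<open>C\<close>, and
outside \<open>A\<close> if \<open>b\<close> is in \<open>A\<close>.
\<close>

lemma avoid_three:
  assumes M: "sing M" and A: "sing A" and B: "sing B" "B \<subset> M" and C: "sing C" "C \<subset> M"
    and y: "y \<in> B" "y \<in> C" "y \<notin> A"
  obtains z where "z \<in> M" "z \<notin> A" "z \<notin> B" "z \<notin> C"
proof -
  obtain b where b: "b \<in> M" "b \<notin> B" "b \<notin> C" using avoid_two[OF M B C] .
  show thesis
  proof (cases "b \<in> A")
    case True
    have yM: "y \<in> M" using y B by blast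
    have "b \<noteq> y" using b y by blast
    obtain z where z: "z \<in> cl {b, y}" "z \<noteq> b" "z \<noteq> y"
      using third_point[OF M b(1) yM \<open>b \<noteq> y\<close>] .
    have z': "z \<in> cl {y, b}" using z by (simp add: insert_commute)
    have "z \<notin> A" by (rule line_meets_once[OF M b(1) yM A True y(3) z(1,2)])
    moreover have "z \<notin> B" by (rule line_meets_once[OF M yM b(1) B(1) y(1) b(2) z' z(3)])
    moreover have "z \<notin> C" by (rule line_meets_once[OF M yM b(1) C(1) y(2) b(3) z' z(3)])
    moreover have "z \<in> M" using span_pair_in[OF M b(1) yM] z by blast
    ultimately show thesis using that by blast
  qed (use that b in blast)
qed

lemma rk_span_Un_le:
  assumes "sing S" "U \<subseteq> S" "V \<subseteq> S" "sing U" "sing V"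
  shows "rk (cl (U \<union> V)) \<le> rk U + rk V"
  using rk_modular[OF assms] by simp

text \<open>
As long as both spans are proper, a point outside both enlarges \<open>Z\<close> by one and keeps it
in general position to \<open>X\<close> and \<open>Y\<close>.
\<close>

lemma common_complement:
  assumes M: "sing M" and X: "sing X" "X \<subseteq> M" and Y: "sing Y" "Y \<subseteq> M" and eq: "rk X = rk Y"
  obtains Z where "sing Z" "Z \<subseteq> M" "rk Z = rk M - rk X" "cl (X \<union> Z) = M" "cl (Y \<union> Z) = M"
proof -
  have "\<exists>Z. sing Z \<and> Z \<subseteq> M \<and> rk Z = i \<and> rk (cl (X \<union> Z)) = rk X + i \<and> rk (cl (Y \<union> Z)) = rk Y + i"
    if "i \<le> rk M - rk X" for i
    using that
  proof (induction i)
    case 0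
    then show ?case using sing_empty sing_span_self X Y by (intro exI[of _ "{}"]) simp
  next
    case (Suc i)
    then obtain Z where Z: "sing Z" "Z \<subseteq> M" "rk Z = i"
      "rk (cl (X \<union> Z)) = rk X + i" "rk (cl (Y \<union> Z)) = rk Y + i" by auto
    have sub: "X \<union> Z \<subseteq> M" "Y \<union> Z \<subseteq> M" using X Y Z by auto
    note A = sing_span_in[OF M sub(1)] span_in[OF M sub(1)]
    note B = sing_span_in[OF M sub(2)] span_in[OF M sub(2)]
    have ne: "cl (X \<union> Z) \<subset> M" "cl (Y \<union> Z) \<subset> M" using Z A B Suc.prems eq by auto
    obtain z where z: "z \<in> M" "z \<notin> cl (X \<union> Z)" "z \<notin> cl (Y \<union> Z)"
      using avoid_two[OF M A(1) ne(1) B(1) ne(2)] .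
    have zZ: "z \<notin> Z" using z(2) in_span by blast
    have zM: "insert z Z \<subseteq> M" using z Z by blast
    have "rk (cl (insert z Z)) = Suc i" using rk_insert_in[OF M Z(2,1) z(1) zZ] Z by simp
    moreover have "rk (cl (X \<union> cl (insert z Z))) = rk X + Suc i"
      using rk_insert_in[OF M A(2,1) z(1,2)] Z by simp
    moreover have "rk (cl (Y \<union> cl (insert z Z))) = rk Y + Suc i"
      using rk_insert_in[OF M B(2,1) z(1,3)] Z by simp
    ultimately show ?case using sing_span_in[OF M zM] span_in[OF M zM] by blast
  qed
  from this[of "rk M - rk X"] obtain Z where Z: "sing Z" "Z \<subseteq> M" "rk Z = rk M - rk X"
    "rk (cl (X \<union> Z)) = rk X + (rk M - rk X)" "rk (cl (Y \<union> Z)) = rk Y + (rk M - rk X)" by auto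
  have sub: "X \<union> Z \<subseteq> M" "Y \<union> Z \<subseteq> M" using X Y Z by auto
  have "rk X \<le> rk M" by (rule rk_mono[OF M X])
  then have "cl (X \<union> Z) = M" "cl (Y \<union> Z) = M"
    using rk_eq_imp_eq[OF M sing_span_in[OF M sub(1)] span_in[OF M sub(1)]]
      rk_eq_imp_eq[OF M sing_span_in[OF M sub(2)] span_in[OF M sub(2)]] Z(4,5) eq by auto
  then show thesis using that Z by blast
qed

lemma insert_hyperplane:
  assumes M: "sing M" and A: "sing A" "A \<subseteq> M" "rk M \<le> Suc (rk A)" and z: "z \<in> M" "z \<notin> A"
  shows "cl (insert z A) = M"
proof -
  have sub: "insert z A \<subseteq> M" using A z by blast
  show ?thesis
    using rk_eq_imp_eq[OF M sing_span_in[OF M sub] span_in[OF M sub]] rk_insert_in[OF M A(2,1) z] A(3)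
    by simp
qed

text \<open>
Three subspaces of equal rank need not have a common complement when lines have only
three points. When \<open>Y\<close> and \<open>Y'\<close> meet in a hyperplane of both and this hyperplane has a
point \<open>y\<close> outside \<open>X\<close>, one exists: take a common complement \<open>Z\<close> of just two subspaces, the
span of \<open>Y\<close> and \<open>Y'\<close> and the span of \<open>X\<close> and \<open>y\<close>. Then \<open>Z\<close> together with each of \<open>X\<close>, \<open>Y\<close>,
\<open>Y'\<close> spans a hyperplane, and one point outside the three hyperplanes completes \<open>Z\<close>. The
point \<open>y\<close> lies in exactly two of these hyperplanes, as \<open>avoid_three\<close> asks.
\<close>

lemma common_complement_three:
  assumes M: "sing M" and X: "sing X" "X \<subseteq> M" "rk X = m"
    and Y: "sing Y" "Y \<subseteq> M" "rk Y = m" and Y': "sing Y'" "Y' \<subseteq> M" "rk Y' = m"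
    and adj: "Suc (rk (Y \<inter> Y')) = m" and y: "y \<in> Y" "y \<in> Y'" "y \<notin> X"
  obtains Z where "sing Z" "Z \<subseteq> M" "rk Z \<le> rk M - m"
    "cl (X \<union> Z) = M" "cl (Y \<union> Z) = M" "cl (Y' \<union> Z) = M"
proof -
  let ?D = "cl (Y \<union> Y')" and ?E = "cl (insert y X)"
  have yM: "y \<in> M" using y Y by blast
  have sub: "Y \<union> Y' \<subseteq> M" "insert y X \<subseteq> M" using X Y Y' yM by auto
  note D = sing_span_in[OF M sub(1)] span_in[OF M sub(1)]
  note E = sing_span_in[OF M sub(2)] span_in[OF M sub(2)]
  have rD: "rk ?D = Suc m" using rk_modular[OF M Y(2) Y'(2) Y(1) Y'(1)] adj Y Y' by simp
  have rE: "rk ?E = Suc m" using rk_insert_in[OF M X(2,1) yM y(3)] X by simp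
  obtain Z where Z: "sing Z" "Z \<subseteq> M" "rk Z = rk M - Suc m" "cl (?D \<union> Z) = M" "cl (?E \<union> Z) = M"
    using common_complement[OF M D E] rD rE by metis
  have mM: "Suc m \<le> rk M" using rk_mono[OF M E] rE by simp
  have hyp: "sing (cl (W \<union> Z))" "cl (W \<union> Z) \<subset> M" "rk M \<le> Suc (rk (cl (W \<union> Z)))" "e \<notin> cl (W \<union> Z)"
    if W: "sing W" "W \<subseteq> M" "rk W = m" and e: "e \<in> M" "cl (insert e (W \<union> Z)) = M" for W e
  proof -
    have WZ: "W \<union> Z \<subseteq> M" using W Z by blast
    show s: "sing (cl (W \<union> Z))" by (rule sing_span_in[OF M WZ])
    have "rk (cl (W \<union> Z)) \<le> rk M - 1" using rk_span_Un_le[OF M W(2) Z(2) W(1) Z(1)] W Z mM by simp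
    then have "cl (W \<union> Z) \<noteq> M" using mM by auto
    then show "cl (W \<union> Z) \<subset> M" using span_in[OF M WZ] by blast
    show "e \<notin> cl (W \<union> Z)"
      using span_insert_redundant[of e P L "W \<union> Z"] e \<open>cl (W \<union> Z) \<noteq> M\<close> by auto
    then show "rk M \<le> Suc (rk (cl (W \<union> Z)))"
      using rk_insert_in[OF M span_in[OF M WZ] s e(1)] e(2) by simp
  qed
  have DM: "cl (insert e (W \<union> Z)) = M"
    if W: "sing W" "W \<subseteq> M" "rk W = m" "W \<subseteq> ?D" and e: "e \<in> ?D" "e \<notin> W" for W e
  proof -
    have "cl (insert e W) = ?D"
      by (rule insert_hyperplane[OF D(1) W(1,4) _ e]) (use rD W in simp)
    then have "M = cl (cl (insert e W) \<union> Z)" using Z(4) by simp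
    then show ?thesis by simp
  qed
  have YD: "Y \<subseteq> ?D" "Y' \<subseteq> ?D" using in_span by auto
  have "Y \<inter> Y' \<noteq> Y" "Y \<inter> Y' \<noteq> Y'" using adj Y(3) Y'(3) by (metis n_not_Suc_n)+
  then obtain d d' where d: "d \<in> Y'" "d \<notin> Y" "d' \<in> Y" "d' \<notin> Y'" by blast
  have dD: "d \<in> ?D" "d' \<in> ?D" using d YD by auto
  have A: "cl (insert y (X \<union> Z)) = M" using Z(5) by simp
  note hA = hyp[OF X yM A]
  note hB = hyp[OF Y _ DM[OF Y YD(1) dD(1) d(2)]]
  note hC = hyp[OF Y' _ DM[OF Y' YD(2) dD(2) d(4)]]
  have dM: "d \<in> M" "d' \<in> M" using dD D by auto
  have yZ: "y \<in> cl (Y \<union> Z)" "y \<in> cl (Y' \<union> Z)" using y by (auto intro: in_span)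
  obtain z where z: "z \<in> M" "z \<notin> cl (X \<union> Z)" "z \<notin> cl (Y \<union> Z)" "z \<notin> cl (Y' \<union> Z)"
    using avoid_three[OF M hA(1) hB(1,2)[OF dM(1)] hC(1,2)[OF dM(2)] yZ hA(4)] .
  have zM: "insert z Z \<subseteq> M" using z Z by blast
  have join: "cl (W \<union> cl (insert z Z)) = M"
    if "sing (cl (W \<union> Z))" "cl (W \<union> Z) \<subset> M" "rk M \<le> Suc (rk (cl (W \<union> Z)))" "z \<notin> cl (W \<union> Z)" for W
    using insert_hyperplane[OF M that(1) _ that(3) z(1) that(4)] that(2) by auto
  have "z \<notin> Z" using z(2) in_span by blast
  then have "rk (cl (insert z Z)) \<le> rk M - m" using rk_insert_in[OF M Z(2,1) z(1)] Z(3) mM by simp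
  then show thesis
    using that[OF sing_span_in[OF M zM] span_in[OF M zM]] join[OF hA(1-3) z(2)]
      join[OF hB(1-3)[OF dM(1)] z(3)] join[OF hC(1-3)[OF dM(2)] z(4)] by blast
qed

section \<open>Maximal singular subspaces\<close>

lemma Max_rk: "M \<in> Max_sing \<Longrightarrow> rk M = n"
  using maximal_pdim[of M] pdim_eq_rk[of M] by simp

lemma rk_le_n: "sing S \<Longrightarrow> rk S \<le> n"
  by (metis Max_rk Max_sing_sing rk_mono sing_in_Max_sing)

lemma Max_iff_rk:
  assumes "sing S"
  shows "S \<in> Max_sing \<longleftrightarrow> rk S = n"
proof
  assume r: "rk S = n"
  obtain M where M: "M \<in> Max_sing" "S \<subseteq> M" using sing_in_Max_sing[OF assms] .
  then have "S = M" using rk_eq_imp_eq[OF Max_sing_sing assms] Max_rk r by simp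
  then show "S \<in> Max_sing" using M by simp
qed (rule Max_rk)

lemma perp_point_hyperplane:
  assumes S: "sing S" and q: "q \<in> P" and a: "a \<in> S" "a \<notin> orth {q}"
  shows "cl (insert a (orth {q} \<inter> S)) = S"
proof
  show "cl (insert a (orth {q} \<inter> S)) \<subseteq> S" by (rule span_in[OF S]) (use a in auto)
  show "S \<subseteq> cl (insert a (orth {q} \<inter> S))"
  proof
    fix y assume y: "y \<in> S"
    show "y \<in> cl (insert a (orth {q} \<inter> S))"
    proof (cases "y = a")
      case True
      then show ?thesis by (simp add: in_span)
    next
      case False
      have l: "cl {a, y} \<in> L" by (rule sing_line_through[OF S a(1) y]) (use False in auto)
      then obtain p where p: "p \<in> cl {a, y}" "collinear P L q p"
        using P3[OF q l] in_span_pair by metis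
      have pS: "p \<in> S" using span_pair_in[OF S a(1) y] p by blast
      have pq: "p \<in> orth {q}"
        using p(2) collinear_sym unfolding perp_def collinear_def by blast
      then have "p \<noteq> a" using a by blast
      then have "y \<in> cl {a, p}" using span_pair_exchange[OF S a(1) y p(1)] by blast
      moreover have "cl {a, p} \<subseteq> cl (insert a (orth {q} \<inter> S))"
        by (rule span_mono) (use pq pS in auto)
      ultimately show ?thesis by blast
    qed
  qed
qed

lemma sing_perp_Int: "sing S \<Longrightarrow> sing (orth X \<inter> S)"
  using sing_Int[OF _ subspace_perp] by (simp add: Int_commute)

lemma rk_perp_point_ge:
  assumes S: "sing S" and q: "q \<in> P"
  shows "rk S \<le> Suc (rk (orth {q} \<inter> S))"
proof (cases "S \<subseteq> orth {q}")
  case True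
  then show ?thesis by (simp add: Int_absorb1)
next
  case False
  then obtain a where a: "a \<in> S" "a \<notin> orth {q}" by blast
  then show ?thesis
    using rk_insert_in[OF S _ sing_perp_Int[OF S] a(1), of "{q}"] perp_point_hyperplane[OF S q a] by simp
qed

lemma rk_perp_ge:
  assumes S: "sing S" and B: "finite B" "B \<subseteq> P"
  shows "rk S \<le> rk (orth B \<inter> S) + card B"
  using B
proof (induction B rule: finite_induct)
  case empty
  have "orth {} \<inter> S = S" using sing_carrier[OF S] unfolding perp_def by blast
  then show ?case by simp
next
  case (insert b B)
  have "orth (insert b B) \<inter> S = orth {b} \<inter> (orth B \<inter> S)" unfolding perp_def by blast
  then show ?case using rk_perp_point_ge[OF sing_perp_Int[OF S], of b B] insert by simp
qed

text \<open>
The points of a maximal singular subspace collinear to a point outside it form a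
hyperplane, and together with the point they span another maximal singular subspace.
\<close>

lemma project_maximal:
  assumes N: "N \<in> Max_sing" and q: "q \<in> P" "q \<notin> N"
  defines "H \<equiv> orth {q} \<inter> N"
  shows "sing H" "Suc (rk H) = n" "q \<in> orth H" "cl (insert q H) \<in> Max_sing" "cl (insert q H) \<inter> N = H"
proof -
  have sN: "sing N" by (rule Max_sing_sing[OF N])
  show sH: "sing H" unfolding H_def by (rule sing_perp_Int[OF sN])
  have HN: "H \<subseteq> N" unfolding H_def by blast
  have "\<not> N \<subseteq> orth {q}"
  proof
    assume "N \<subseteq> orth {q}"
    then have "q \<in> orth N" using subset_perp_sym[of N "{q}"] q by simp
    then have "sing (cl (insert q N))" by (rule sing_span_insert[OF sN])
    moreover have "N \<subseteq> cl (insert q N)" using in_span by auto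
    ultimately have "cl (insert q N) = N" by (rule Max_sing_eq[OF N])
    then show False using q in_span[of q "insert q N"] by simp
  qed
  then obtain a where a: "a \<in> N" "a \<notin> orth {q}" by blast
  show rH: "Suc (rk H) = n"
    using rk_insert_in[OF sN HN sH a(1)] perp_point_hyperplane[OF sN q(1) a] a Max_rk[OF N]
    unfolding H_def by simp
  show qH: "q \<in> orth H" using subset_perp_sym[of H "{q}"] q unfolding H_def by simp
  have qn: "q \<notin> H" using q HN by blast
  have s: "sing (cl (insert q H))" by (rule sing_span_insert[OF sH qH])
  show Mx: "cl (insert q H) \<in> Max_sing"
    unfolding Max_iff_rk[OF s] using rk_insert[OF sH qH qn] rH by simp
  have "H \<subseteq> cl (insert q H) \<inter> N" using HN in_span by auto
  moreover have "cl (insert q H) \<inter> N \<subset> N"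
  proof -
    have "q \<in> cl (insert q H)" by (rule in_span) simp
    then show ?thesis using Max_sing_eq[OF N s] q by blast
  qed
  ultimately show "cl (insert q H) \<inter> N = H"
    using rk_strict_mono[OF sN sing_Int[OF s sing_subspace[OF sN]]]
      rk_strict_mono[OF sing_Int[OF s sing_subspace[OF sN]] sH] rH Max_rk[OF N] by fastforce
qed

text \<open>
If \<open>N\<close> meets \<open>M\<close> in a point \<open>x\<close>, projecting \<open>N\<close> from a point \<open>q\<close> not collinear to \<open>x\<close> gives a
maximal singular subspace meeting \<open>M\<close> in less: a point \<open>z\<close> of \<open>M\<close> on a line \<open>q h\<close> with \<open>h\<close> in
\<open>N\<close> must be \<open>h\<close>, for otherwise \<open>q\<close> is on the line \<open>h z\<close>, all of whose points are collinear
to \<open>x\<close>.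
\<close>

lemma opposite_maximal:
  assumes M: "M \<in> Max_sing"
  obtains N where "N \<in> Max_sing" "M \<inter> N = {}"
proof -
  obtain N where N: "N \<in> Max_sing" and least: "\<And>K. K \<in> Max_sing \<Longrightarrow> rk (M \<inter> N) \<le> rk (M \<inter> K)"
    using ex_has_least_nat[of "\<lambda>K. K \<in> Max_sing" M "\<lambda>K. rk (M \<inter> K)"] M by blast
  have s: "sing M" "sing N" using M N Max_sing_sing by auto
  have "M \<inter> N = {}"
  proof (rule ccontr)
    assume "M \<inter> N \<noteq> {}"
    then obtain x where x: "x \<in> M" "x \<in> N" by blast
    have "x \<in> P" using x sing_carrier[OF s(1)] by blast
    then obtain q where q: "q \<in> P" "\<not> collinear P L x q" using P2 by blast
    have "q \<notin> N" using q x sing_collinear[OF s(2)] by blast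
    define H where "H = orth {q} \<inter> N"
    note H = project_maximal[OF N q(1) \<open>q \<notin> N\<close>, folded H_def]
    let ?K = "cl (insert q H)"
    have "H \<noteq> {}" using H(2) rank_ge_3 by auto
    have HN: "H \<subseteq> N" unfolding H_def by blast
    have sK: "sing ?K" by (rule Max_sing_sing[OF H(4)])
    have "M \<inter> ?K \<subseteq> H"
    proof
      fix z assume z: "z \<in> M \<inter> ?K"
      obtain h where h: "h \<in> H" "z \<in> cl {q, h}"
        using cone[OF H(1,3) _ \<open>H \<noteq> {}\<close>] \<open>q \<notin> N\<close> HN z by blast
      have "z = h"
      proof (rule ccontr)
        assume "z \<noteq> h"
        have "h \<in> ?K" "q \<in> ?K" using h in_span by auto
        then have "q \<in> cl {h, z}"
          using span_pair_exchange[OF sK, of h q z] h \<open>z \<noteq> h\<close> by (simp add: insert_commute)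
        moreover have "cl {h, z} \<subseteq> orth {x}"
        proof (rule span_least[OF subspace_perp])
          have "h \<in> orth {x}" by (rule in_perp[OF s(2)]) (use h HN x in auto)
          moreover have "z \<in> orth {x}" by (rule in_perp[OF s(1)]) (use z x in auto)
          ultimately show "{h, z} \<subseteq> orth {x}" by blast
        qed
        ultimately show False using q collinear_sym unfolding perp_def by blast
      qed
      then show "z \<in> H" using h by simp
    qed
    moreover have "x \<notin> H" using q collinear_sym unfolding H_def perp_def by blast
    ultimately have "M \<inter> ?K \<subset> M \<inter> N" using x HN by blast
    then have "rk (M \<inter> ?K) < rk (M \<inter> N)"
      using rk_strict_mono sing_Int[OF s(1) sing_subspace] sK s(2) by blast
    then show False using least[OF H(4)] by simp
  qed
  then show thesis using that N by blast
qed

text \<open>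
In a maximal singular subspace opposite to \<open>M\<close> each of the \<open>n - 1\<close> generators of \<open>H\<close> cuts
the rank by at most one, so a point collinear to all of \<open>H\<close> remains, and it is not in \<open>M\<close>.
\<close>

lemma hyperplane_in_other_maximal:
  assumes M: "M \<in> Max_sing" and H: "sing H" "H \<subseteq> M" "Suc (rk H) = n"
  obtains N where "N \<in> Max_sing" "H \<subseteq> N" "N \<noteq> M"
proof -
  obtain M' where M': "M' \<in> Max_sing" "M \<inter> M' = {}" using opposite_maximal[OF M] .
  obtain B where B: "finite B" "B \<subseteq> H" "card B = rk H" "cl B = H" using rk_witness[OF H(1)] .
  have BP: "B \<subseteq> P" using B sing_carrier[OF H(1)] by blast
  have "n \<le> rk (orth H \<inter> M') + rk H"
    using rk_perp_ge[OF Max_sing_sing[OF M'(1)] B(1) BP] perp_span[OF BP] B Max_rk[OF M'(1)] by simp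
  then have "orth H \<inter> M' \<noteq> {}" using H(3) by auto
  then obtain r where r: "r \<in> orth H" "r \<in> M'" by blast
  have "r \<notin> M" using r M' by blast
  have s: "sing (cl (insert r H))" by (rule sing_span_insert[OF H(1) r(1)])
  have "r \<notin> H" using \<open>r \<notin> M\<close> H by blast
  then have "cl (insert r H) \<in> Max_sing"
    unfolding Max_iff_rk[OF s] using rk_insert[OF H(1) r(1)] H(3) by simp
  moreover have "r \<in> cl (insert r H)" "H \<subseteq> cl (insert r H)" using in_span by auto
  ultimately show thesis using that \<open>r \<notin> M\<close> by blast
qed

lemma maximal_separating:
  assumes U: "sing U" "x \<notin> U"
  obtains M where "M \<in> Max_sing" "U \<subseteq> M" "x \<notin> M"
proof -
  obtain M where M: "M \<in> Max_sing" "U \<subseteq> M" using sing_in_Max_sing[OF U(1)] .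
  show thesis
  proof (cases "x \<in> M")
    case True
    have sM: "sing M" by (rule Max_sing_sing[OF M(1)])
    obtain H where H: "sing H" "U \<subseteq> H" "H \<subseteq> M" "x \<notin> H" "rk M = Suc (rk H)"
      using hyperplane_avoiding[OF sM U(1) M(2) True U(2)] .
    have rH: "Suc (rk H) = n" using H Max_rk[OF M(1)] by simp
    obtain N where N: "N \<in> Max_sing" "H \<subseteq> N" "N \<noteq> M"
      using hyperplane_in_other_maximal[OF M(1) H(1,3) rH] .
    have "x \<notin> N"
    proof
      assume "x \<in> N"
      have "M = cl (insert x H)" 
        by (rule insert_hyperplane[OF sM H(1,3) _ True H(4), symmetric]) (use H in simp)
      also have "\<dots> \<subseteq> N" by (rule span_in[OF Max_sing_sing[OF N(1)]]) (use N \<open>x \<in> N\<close> in auto)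
      finally show False using Max_sing_eq[OF M(1) Max_sing_sing[OF N(1)]] N(3) by blast
    qed
    then show thesis using that N H by blast
  qed (use that M in blast)
qed

text \<open>
Two maximal singular subspaces through \<open>W\<close> are linked by a chain of maximal singular
subspaces through \<open>W\<close> in which consecutive members meet in a hyperplane.
\<close>

lemma maximal_connected:
  assumes M: "M \<in> Max_sing" and N: "N \<in> Max_sing" and W: "W \<subseteq> M \<inter> N"
    and base: "Q M"
    and step: "\<And>N N'. N \<in> Max_sing \<Longrightarrow> N' \<in> Max_sing \<Longrightarrow> W \<subseteq> N \<inter> N' \<Longrightarrow>
      Suc (rk (N \<inter> N')) = n \<Longrightarrow> Q N \<Longrightarrow> Q N'"
  shows "Q N"
  using N W
proof (induction "n - rk (M \<inter> N)" arbitrary: N rule: less_induct)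
  case less
  show ?case
  proof (cases "M \<subseteq> N")
    case True
    then show ?thesis using Max_sing_eq[OF M Max_sing_sing] less.prems base by blast
  next
    case False
    then obtain x where x: "x \<in> M" "x \<notin> N" by blast
    have sM: "sing M" and sN: "sing N" using M less.prems Max_sing_sing by auto
    have xP: "x \<in> P" using x sing_carrier[OF sM] by blast
    define H where "H = orth {x} \<inter> N"
    note H = project_maximal[OF less.prems(1) xP x(2), folded H_def]
    let ?N = "cl (insert x H)"
    have sub: "M \<inter> N \<subseteq> H"
      using in_perp[OF sM, of _ "{x}"] x unfolding H_def by blast
    have K: "H \<subseteq> ?N" "x \<in> ?N" using in_span by auto
    have sK: "sing ?N" by (rule Max_sing_sing[OF H(4)])
    have sMK: "sing (M \<inter> ?N)" "sing (M \<inter> N)" using sing_Int[OF sM] sing_subspace sK sN by auto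
    have "rk (M \<inter> N) < rk (M \<inter> ?N)"
      by (rule rk_strict_mono[OF sMK]) (use sub K x in blast)
    moreover have "rk (M \<inter> ?N) \<le> n" by (rule rk_le_n[OF sMK(1)])
    ultimately have "n - rk (M \<inter> ?N) < n - rk (M \<inter> N)" by linarith
    moreover have WN: "W \<subseteq> M \<inter> ?N" "W \<subseteq> ?N \<inter> N" using less.prems(2) sub K by auto
    ultimately have "Q ?N" using less.hyps H(4) by blast
    moreover have "Suc (rk (?N \<inter> N)) = n" using H(2,5) by simp
    ultimately show ?thesis using step[OF H(4) less.prems(1) WN(2)] by blast
  qed
qed

section \<open>Connectedness of the supplements of a flat\<close>

definition flats :: "nat \<Rightarrow> 'a set set" where
  "flats j = {S. sing S \<and> rk S = j}"

lemma flats_sing: "X \<in> flats j \<Longrightarrow> sing X"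
  and flats_rk: "X \<in> flats j \<Longrightarrow> rk X = j"
  and flatsI: "sing X \<Longrightarrow> rk X = j \<Longrightarrow> X \<in> flats j"
  unfolding flats_def by auto

lemma flat_between:
  assumes "sing U" "rk U \<le> j" "sing V" "U \<subseteq> V" "j \<le> rk V"
  obtains X where "X \<in> flats j" "U \<subseteq> X" "X \<subseteq> V"
  using rk_between[OF assms(3,1,4,2,5)] flatsI by blast

text \<open>
The flats \<open>Z\<close> of rank \<open>m\<close> that together with \<open>X\<close> span \<open>M\<close> are connected under exchanging one
dimension at a time. To get closer to \<open>Z'\<close>, drop from \<open>Z\<close> down to a hyperplane \<open>H\<close> through
\<open>Z \<inter> Z'\<close> and add a point \<open>c\<close> of \<open>Z'\<close>. Dropping may cost the spanning property, but then
\<open>Z'\<close>, which also spans \<open>M\<close> with \<open>X\<close>, has a point \<open>c\<close> that restores it.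
\<close>

lemma supplement_chain:
  assumes M: "sing M" and X: "sing X" "X \<subseteq> M"
    and Z: "Z \<in> flats m" "Z \<subseteq> M" "cl (X \<union> Z) = M"
    and Z': "Z' \<in> flats m" "Z' \<subseteq> M" "cl (X \<union> Z') = M"
    and Q: "Q Z"
    and step: "\<And>A B. A \<in> flats m \<Longrightarrow> A \<subseteq> M \<Longrightarrow> cl (X \<union> A) = M \<Longrightarrow>
      B \<in> flats m \<Longrightarrow> B \<subseteq> M \<Longrightarrow> cl (X \<union> B) = M \<Longrightarrow> Suc (rk (A \<inter> B)) = m \<Longrightarrow> Q A \<Longrightarrow> Q B"
  shows "Q Z'"
  using Z Q
proof (induction "m - rk (Z \<inter> Z')" arbitrary: Z rule: less_induct)
  case less
  note Z = less.prems(1-3)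
  have s: "sing Z" "sing Z'" "rk Z = m" "rk Z' = m" using Z(1) Z'(1) flats_sing flats_rk by auto
  have sI: "sing (Z \<inter> Z')" using sing_Int[OF s(1) sing_subspace[OF s(2)]] .
  show ?case
  proof (cases "Z = Z'")
    case True
    then show ?thesis using less.prems by simp
  next
    case False
    have "\<not> Z \<subseteq> Z'" "\<not> Z' \<subseteq> Z"
      using rk_eq_imp_eq[OF s(2,1)] rk_eq_imp_eq[OF s(1,2)] s(3,4) False by auto
    then obtain z z' where z: "z \<in> Z" "z \<notin> Z'" "z' \<in> Z'" "z' \<notin> Z" by blast
    have "z \<notin> Z \<inter> Z'" using z by blast
    then obtain H where H: "sing H" "Z \<inter> Z' \<subseteq> H" "H \<subseteq> Z" "z \<notin> H" "rk Z = Suc (rk H)"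
      using hyperplane_avoiding[OF s(1) sI Int_lower1 z(1)] by metis
    have Zz: "cl (insert z H) = Z"
      by (rule insert_hyperplane[OF s(1) H(1,3) _ z(1) H(4)]) (use H in simp)
    let ?K = "cl (X \<union> H)"
    have sub: "X \<union> H \<subseteq> M" using X H Z by blast
    have K: "sing ?K" "?K \<subseteq> M" by (rule sing_span_in[OF M sub], rule span_in[OF M sub])
    have "M = cl (X \<union> cl (insert z H))" using Zz Z(3) by simp
    then have MK: "M = cl (insert z ?K)" by simp
    have zM: "z \<in> M" using z Z by blast
    have "\<exists>c\<in>Z'. c \<notin> Z \<and> (?K = M \<or> c \<notin> ?K)"
    proof (cases "?K = M")
      case False
      have "\<not> Z' \<subseteq> ?K"
      proof
        assume "Z' \<subseteq> ?K"
        then have "X \<union> Z' \<subseteq> ?K" using in_span[of _ "X \<union> H"] by blast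
        then have "M \<subseteq> ?K" using span_in[OF K(1)] Z'(3) by blast
        then show False using False K by blast
      qed
      then obtain c where c: "c \<in> Z'" "c \<notin> ?K" by blast
      moreover have "H \<subseteq> ?K" using in_span[of _ "X \<union> H"] by blast
      ultimately have "c \<notin> Z" using H(2) by blast
      then show ?thesis using c by blast
    qed (use z in blast)
    then obtain c where c: "c \<in> Z'" "c \<notin> Z" "?K = M \<or> c \<notin> ?K" by blast
    have cM: "c \<in> M" "c \<notin> H" using c Z' H by auto
    let ?Y = "cl (insert c H)"
    have cH: "insert c H \<subseteq> M" using cM sub by blast
    have Y: "sing ?Y" "?Y \<subseteq> M" by (rule sing_span_in[OF M cH], rule span_in[OF M cH])
    have HM: "H \<subseteq> M" using sub by blast
    have rY: "rk ?Y = m" using rk_insert_in[OF M HM H(1) cM] H(5) s by simp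
    have XY: "cl (X \<union> ?Y) = M"
    proof -
      have "cl (insert c ?K) = M"
      proof (cases "c \<in> ?K")
        case True
        then have "c \<in> cl ?K" by (rule in_span)
        then have "cl (insert c ?K) = cl ?K" by (rule span_insert_redundant)
        moreover have "?K = M" using True c(3) by blast
        ultimately show ?thesis using sing_span_self[OF M] by simp
      next
        case False
        have "rk M \<le> Suc (rk ?K)"
          using MK rk_insert_in[OF M K(2,1) zM] span_insert_redundant[of z P L "X \<union> H"]
          by (cases "z \<in> ?K") auto
        then show ?thesis using insert_hyperplane[OF M K _ cM(1) False] by blast
      qed
      then show ?thesis by simp
    qed
    have mem: "c \<in> ?Y" "H \<subseteq> ?Y" using in_span[of _ "insert c H"] by blast+
    have sZY: "sing (Z \<inter> ?Y)" using sing_Int[OF s(1) sing_subspace[OF Y(1)]] .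
    have "rk (Z \<inter> ?Y) < m"
      using rk_strict_mono[OF Y(1) sZY] rY mem c(2) by blast
    moreover have "rk H \<le> rk (Z \<inter> ?Y)" by (rule rk_mono[OF sZY H(1)]) (use H mem in blast)
    ultimately have adj: "Suc (rk (Z \<inter> ?Y)) = m" using H(5) s by simp
    have sYZ: "sing (?Y \<inter> Z')" using sing_Int[OF Y(1) sing_subspace[OF s(2)]] .
    have "rk (Z \<inter> Z') < rk (?Y \<inter> Z')"
      by (rule rk_strict_mono[OF sYZ sI]) (use H mem c in blast)
    moreover have "rk (?Y \<inter> Z') \<le> m" using rk_mono[OF s(2) sYZ] s by simp
    ultimately have "m - rk (?Y \<inter> Z') < m - rk (Z \<inter> Z')" by linarith
    moreover have Yf: "?Y \<in> flats m" by (rule flatsI[OF Y(1) rY])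
    moreover have "Q ?Y" by (rule step[OF Z Yf Y(2) XY adj less.prems(4)])
    ultimately show ?thesis using less.hyps Y(2) XY by blast
  qed
qed

section \<open>The graph and the maximal singular subspaces\<close>

definition spanning :: "nat \<Rightarrow> ('a set \<times> 'a set) set" where
  "spanning m = {(X, Y). X \<in> flats m \<and> Y \<in> flats m \<and> cl (X \<union> Y) \<in> Max_sing}"

lemma spanning_sym: "(X, Y) \<in> spanning m \<Longrightarrow> (Y, X) \<in> spanning m"
  unfolding spanning_def by (simp add: Un_commute)

lemma spanningD:
  assumes "(X, Y) \<in> spanning m"
  shows "X \<in> flats m" "Y \<in> flats m" "cl (X \<union> Y) \<in> Max_sing"
  using assms unfolding spanning_def by auto

lemma spanning_perp: "(X, Y) \<in> spanning m \<Longrightarrow> X \<union> Y \<subseteq> orth (X \<union> Y)"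
  using sing_iff_perp[of "cl (X \<union> Y)"] Max_sing_sing[OF spanningD(3)]
    span_superset[of "X \<union> Y" P L] perp_antimono[OF span_superset[of "X \<union> Y" P L]] by blast

lemma perp_Un: "orth (X \<union> Y) = orth X \<inter> orth Y"
  unfolding perp_def by blast

text \<open>
Pairwise orthogonal flats lie in one singular subspace, hence in the maximal one that
two of them already span.
\<close>

lemma spanning_triangle:
  assumes AB: "(A, B) \<in> spanning m" and AC: "(A, C) \<in> spanning m" and BC: "(B, C) \<in> spanning m"
  shows "cl (A \<union> C) = cl (A \<union> B)"
proof -
  have "A \<union> B \<union> C \<subseteq> orth (A \<union> B \<union> C)"
    using spanning_perp[OF AB] spanning_perp[OF AC] spanning_perp[OF BC] unfolding perp_Un by blast
  then have s: "sing (cl (A \<union> B \<union> C))" by (rule sing_span)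
  have "cl (A \<union> B) \<subseteq> cl (A \<union> B \<union> C)" by (rule span_mono) blast
  then have 1: "cl (A \<union> B \<union> C) = cl (A \<union> B)" by (rule Max_sing_eq[OF spanningD(3)[OF AB] s])
  have "cl (A \<union> C) \<subseteq> cl (A \<union> B \<union> C)" by (rule span_mono) blast
  then have "cl (A \<union> B \<union> C) = cl (A \<union> C)" by (rule Max_sing_eq[OF spanningD(3)[OF AC] s])
  with 1 show ?thesis by simp
qed

text \<open>
By the dimension formula two orthogonal flats of rank \<open>n - t\<close> span a subspace of rank \<open>n\<close>
exactly when their intersection has rank \<open>n - 2t\<close>.
\<close>

lemma rel_0_eq_spanning:
  assumes k: "k = int n - t - 1" and m: "int m = int n - t" and t: "t \<le> int m"
  shows "polar_grassmannian P L k = flats m" "rel_0 P L k t = spanning m"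
proof -
  show G: "polar_grassmannian P L k = flats m"
    unfolding polar_grassmannian_def flats_def pdim_eq_rk using k m by auto
  have "(X, Y) \<in> rel_0 P L k t \<longleftrightarrow> (X, Y) \<in> spanning m" for X Y
  proof (cases "X \<in> flats m \<and> Y \<in> flats m")
    case True
    then have XY: "sing X" "sing Y" "rk X = m" "rk Y = m" using flats_sing flats_rk by auto
    show ?thesis
    proof
      assume "(X, Y) \<in> rel_0 P L k t"
      then have r: "rk (orth X \<inter> Y) = m" "int (rk (X \<inter> Y)) = int m - t"
        unfolding rel_0_def pdim_eq_rk using k m by auto
      have "orth X \<inter> Y = Y"
        by (rule rk_eq_imp_eq[OF XY(2) sing_perp_Int[OF XY(2)]]) (use r XY in auto)
      then have "Y \<subseteq> orth X" by blast
      then have S: "sing (cl (X \<union> Y))" by (rule sing_span_Un[OF XY(1,2)])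
      have "rk (cl (X \<union> Y)) + rk (X \<inter> Y) = m + m"
        using rk_modular[OF S _ _ XY(1,2)] in_span[of _ "X \<union> Y"] XY by auto
      then have "rk (cl (X \<union> Y)) = n" using r m by linarith
      then show "(X, Y) \<in> spanning m" using True Max_iff_rk[OF S] unfolding spanning_def by blast
    next
      assume a: "(X, Y) \<in> spanning m"
      have Mx: "cl (X \<union> Y) \<in> Max_sing" by (rule spanningD(3)[OF a])
      have "rk (cl (X \<union> Y)) + rk (X \<inter> Y) = m + m"
        using rk_modular[OF Max_sing_sing[OF Mx] _ _ XY(1,2)] in_span[of _ "X \<union> Y"] XY by auto
      then have "int (rk (X \<inter> Y)) = int m - t" using m Max_rk[OF Mx] by linarith
      moreover have "orth X \<inter> Y = Y" using spanning_perp[OF a] unfolding perp_Un by blast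
      ultimately show "(X, Y) \<in> rel_0 P L k t"
        unfolding rel_0_def pdim_eq_rk G using True XY k m by auto
    qed
  next
    case False
    then show ?thesis unfolding rel_0_def spanning_def G by blast
  qed
  then show "rel_0 P L k t = spanning m" by auto
qed

lemma spanning_pair_in:
  assumes M: "M \<in> Max_sing" and X: "X \<in> flats m" "X \<subseteq> M" and Y: "Y \<in> flats m" "Y \<subseteq> M"
    and m: "n \<le> 2 * m" "m \<le> n"
  obtains Z where "(X, Z) \<in> spanning m" "(Y, Z) \<in> spanning m" "Z \<subseteq> M"
    "cl (X \<union> Z) = M" "cl (Y \<union> Z) = M"
proof -
  note sM = Max_sing_sing[OF M]
  have s: "sing X" "sing Y" "rk X = m" "rk Y = m" using X Y flats_sing flats_rk by auto
  obtain Z0 where Z0: "sing Z0" "Z0 \<subseteq> M" "rk Z0 = rk M - rk X" "cl (X \<union> Z0) = M" "cl (Y \<union> Z0) = M"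
    using common_complement[OF sM s(1) X(2) s(2) Y(2)] s by metis
  obtain Z where Z: "Z \<in> flats m" "Z0 \<subseteq> Z" "Z \<subseteq> M"
    by (rule flat_between[OF Z0(1) _ sM Z0(2), of m]) (use Z0 s Max_rk[OF M] m in auto)
  have "cl (W \<union> Z) = M" if "W \<subseteq> M" "cl (W \<union> Z0) = M" for W
    using span_in[OF sM, of "W \<union> Z"] span_mono[of "W \<union> Z0" "W \<union> Z" P L] that Z by blast
  then have "cl (X \<union> Z) = M" "cl (Y \<union> Z) = M" using Z0 X Y by auto
  then show thesis using that Z X Y M unfolding spanning_def by auto
qed

text \<open>
The span of all images \<open>f X\<close> avoids a choice; for a graph automorphism \<open>f\<close> any two
adjacent \<open>X\<close>, \<open>Z\<close> that span \<open>M\<close> suffice.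
\<close>

definition induced :: "nat \<Rightarrow> ('a set \<Rightarrow> 'a set) \<Rightarrow> 'a set \<Rightarrow> 'a set" where
  "induced m f M = cl (\<Union>X\<in>{X \<in> flats m. X \<subseteq> M}. f X)"

context
  fixes m :: nat and f :: "'a set \<Rightarrow> 'a set"
  assumes m: "n \<le> 2 * m" "m + 2 \<le> n" and aut: "graph_automorphism (flats m) (spanning m) f"
begin

lemma aut_flats: "X \<in> flats m \<Longrightarrow> f X \<in> flats m"
  using aut unfolding graph_automorphism_def bij_betw_def by blast

lemma aut_spanning: "(X, Y) \<in> spanning m \<Longrightarrow> (f X, f Y) \<in> spanning m"
  using aut spanningD[of X Y m] unfolding graph_automorphism_def by blast

text \<open>
With \<open>X\<close> fixed, the flats \<open>Z\<close> spanning \<open>M\<close> with \<open>X\<close> are connected by exchanges of one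
dimension, and for such an exchange from \<open>A\<close> to \<open>B\<close> there is a common neighbour \<open>W\<close> of \<open>X\<close>,
\<open>A\<close> and \<open>B\<close>. The triangles \<open>X A W\<close> and \<open>X B W\<close> go to triangles, and these share the edge
from \<open>f X\<close> to \<open>f W\<close>.
\<close>

lemma aut_span_const:
  assumes Z: "(X, Z) \<in> spanning m" and Z': "(X, Z') \<in> spanning m" and eq: "cl (X \<union> Z) = cl (X \<union> Z')"
  shows "cl (f X \<union> f Z') = cl (f X \<union> f Z)"
proof -
  let ?M = "cl (X \<union> Z)"
  note M = spanningD(3)[OF Z]
  have sM: "sing ?M" by (rule Max_sing_sing[OF M])
  note X = spanningD(1)[OF Z]
  have XM: "X \<subseteq> ?M" "Z \<subseteq> ?M" "Z' \<subseteq> ?M"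
    using in_span[of _ "X \<union> Z"] in_span[of _ "X \<union> Z'"] eq by auto
  have rM: "rk ?M = n" by (rule Max_rk[OF M])
  show ?thesis
  proof (rule supplement_chain[OF sM flats_sing[OF X] XM(1) spanningD(2)[OF Z] XM(2) refl
          spanningD(2)[OF Z'] XM(3) eq[symmetric], where Q = "\<lambda>A. cl (f X \<union> f A) = cl (f X \<union> f Z)"])
    fix A B
    assume A: "A \<in> flats m" "A \<subseteq> ?M" "cl (X \<union> A) = ?M"
      and B: "B \<in> flats m" "B \<subseteq> ?M" "cl (X \<union> B) = ?M"
      and AB: "Suc (rk (A \<inter> B)) = m" and QA: "cl (f X \<union> f A) = cl (f X \<union> f Z)"
    have s: "sing X" "sing A" "sing B" "rk X = m" "rk A = m" "rk B = m"
      using X A B flats_sing flats_rk by auto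
    \<comment> \<open>The rank of \<open>A \<inter> B\<close> is \<open>m - 1\<close>, that of \<open>X \<inter> A\<close> is \<open>m - (n - m)\<close>, and \<open>n - m\<close> is at least 2.\<close>
    have "\<not> A \<inter> B \<subseteq> X"
    proof
      assume "A \<inter> B \<subseteq> X"
      then have "rk (A \<inter> B) \<le> rk (X \<inter> A)"
        using s sing_Int sing_subspace by (intro rk_mono) auto
      moreover have "rk ?M + rk (X \<inter> A) = m + m"
        using rk_modular[OF sM XM(1) A(2) s(1,2)] A(3) s by simp
      ultimately show False using AB rM m by linarith
    qed
    then obtain y where y: "y \<in> A" "y \<in> B" "y \<notin> X" by blast
    obtain W0 where W0: "sing W0" "W0 \<subseteq> ?M" "rk W0 \<le> rk ?M - m"
      "cl (X \<union> W0) = ?M" "cl (A \<union> W0) = ?M" "cl (B \<union> W0) = ?M"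
      using common_complement_three[OF sM s(1) XM(1) s(4,2) A(2) s(5,3) B(2) s(6) AB y] .
    obtain W where W: "W \<in> flats m" "W0 \<subseteq> W" "W \<subseteq> ?M"
      by (rule flat_between[OF W0(1) _ sM W0(2), of m]) (use W0 rM m in auto)
    have "cl (V \<union> W) = ?M" if "V \<subseteq> ?M" "cl (V \<union> W0) = ?M" for V
      using span_in[OF sM, of "V \<union> W"] span_mono[of "V \<union> W0" "V \<union> W" P L] that W by blast
    then have adj: "(X, W) \<in> spanning m" "(A, W) \<in> spanning m" "(B, W) \<in> spanning m"
      "(X, A) \<in> spanning m" "(X, B) \<in> spanning m"
      unfolding spanning_def using X A B W W0 XM M by auto
    note fadj = adj[THEN aut_spanning]
    have "cl (f X \<union> f W) = cl (f X \<union> f A)" by (rule spanning_triangle[OF fadj(4,1,2)])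
    moreover have "cl (f X \<union> f W) = cl (f X \<union> f B)" by (rule spanning_triangle[OF fadj(5,1,3)])
    ultimately show "cl (f X \<union> f B) = cl (f X \<union> f Z)" using QA by simp
  qed simp
qed

text \<open>
Two flats \<open>X\<close>, \<open>X'\<close> in \<open>M\<close> have a common neighbour \<open>W\<close> in \<open>M\<close>, so the pairs can be changed one
member at a time.
\<close>

lemma aut_span_well_defined:
  assumes XZ: "(X, Z) \<in> spanning m" "cl (X \<union> Z) = M" and XZ': "(X', Z') \<in> spanning m" "cl (X' \<union> Z') = M"
  shows "cl (f X' \<union> f Z') = cl (f X \<union> f Z)"
proof -
  have M: "M \<in> Max_sing" using spanningD(3)[OF XZ(1)] XZ(2) by simp
  have sub: "X \<subseteq> M" "X' \<subseteq> M" using XZ(2) XZ'(2) in_span[of _ "X \<union> Z"] in_span[of _ "X' \<union> Z'"] by auto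
  have "m \<le> n" using m by simp
  then obtain W where W: "(X, W) \<in> spanning m" "(X', W) \<in> spanning m" "cl (X \<union> W) = M" "cl (X' \<union> W) = M"
    using spanning_pair_in[OF M spanningD(1)[OF XZ(1)] sub(1) spanningD(1)[OF XZ'(1)] sub(2) m(1)]
    by metis
  have "cl (f X' \<union> f Z') = cl (f X' \<union> f W)"
    by (rule aut_span_const[OF W(2) XZ'(1)]) (use W XZ' in simp)
  also have "\<dots> = cl (f W \<union> f X)"
    using aut_span_const[OF spanning_sym[OF W(1)] spanning_sym[OF W(2)]] W by (simp add: Un_commute)
  also have "\<dots> = cl (f X \<union> f Z)"
    using aut_span_const[OF XZ(1) W(1)] W XZ by (simp add: Un_commute)
  finally show ?thesis .
qed

lemma induced_eq:
  assumes XZ: "(X, Z) \<in> spanning m" "cl (X \<union> Z) = M"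
  shows "induced m f M = cl (f X \<union> f Z)"
proof
  have M: "M \<in> Max_sing" using spanningD(3)[OF XZ(1)] XZ(2) by simp
  have sub: "X \<subseteq> M" "Z \<subseteq> M" using XZ(2) in_span[of _ "X \<union> Z"] by auto
  note N = Max_sing_sing[OF spanningD(3)[OF aut_spanning[OF XZ(1)]]]
  show "cl (f X \<union> f Z) \<subseteq> induced m f M"
    unfolding induced_def using sub spanningD(1,2)[OF XZ(1)] by (intro span_mono) blast
  show "induced m f M \<subseteq> cl (f X \<union> f Z)"
    unfolding induced_def
  proof (rule span_in[OF N], rule UN_least)
    fix Y assume "Y \<in> {Y \<in> flats m. Y \<subseteq> M}"
    then have Y: "Y \<in> flats m" "Y \<subseteq> M" by auto
    have "m \<le> n" using m by simp
    then obtain W where W: "(Y, W) \<in> spanning m" "cl (Y \<union> W) = M"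
      using spanning_pair_in[OF M Y Y m(1)] by metis
    have "f Y \<subseteq> cl (f Y \<union> f W)" using in_span[of _ "f Y \<union> f W"] by blast
    then show "f Y \<subseteq> cl (f X \<union> f Z)" using aut_span_well_defined[OF XZ W] by simp
  qed
qed

lemma Max_sing_spanned:
  assumes "M \<in> Max_sing"
  obtains X Z where "(X, Z) \<in> spanning m" "cl (X \<union> Z) = M"
proof -
  obtain X where X: "X \<in> flats m" "X \<subseteq> M"
    by (rule flat_between[OF sing_empty _ Max_sing_sing[OF assms], of m])
      (use Max_rk[OF assms] m in auto)
  have "m \<le> n" using m by simp
  then show thesis using spanning_pair_in[OF assms X X m(1)] that by metis
qed

lemma induced_Max: "M \<in> Max_sing \<Longrightarrow> induced m f M \<in> Max_sing"
  using Max_sing_spanned[of M] induced_eq spanningD(3)[OF aut_spanning] by metis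

lemma induced_mono:
  assumes "X \<in> flats m" "X \<subseteq> M"
  shows "f X \<subseteq> induced m f M"
  unfolding induced_def using assms in_span[of _ "\<Union>X\<in>{X \<in> flats m. X \<subseteq> M}. f X"] by blast

end

lemma inverse_automorphism:
  assumes "graph_automorphism V R f"
  shows "graph_automorphism V R (inv_into V f)"
proof -
  have f: "bij_betw f V V" and R: "\<And>X Y. X \<in> V \<Longrightarrow> Y \<in> V \<Longrightarrow> (X, Y) \<in> R \<longleftrightarrow> (f X, f Y) \<in> R"
    using assms unfolding graph_automorphism_def by auto
  have g: "bij_betw (inv_into V f) V V" by (rule bij_betw_inv_into[OF f])
  moreover have "(X, Y) \<in> R \<longleftrightarrow> (inv_into V f X, inv_into V f Y) \<in> R" if "X \<in> V" "Y \<in> V" for X Y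
    using R[OF bij_betw_apply[OF g that(1)] bij_betw_apply[OF g that(2)]]
    by (simp add: bij_betw_inv_into_right[OF f] that)
  ultimately show ?thesis unfolding graph_automorphism_def by simp
qed

lemma induced_inverse:
  assumes m: "n \<le> 2 * m" "m + 2 \<le> n" and f: "graph_automorphism (flats m) (spanning m) f"
    and g: "graph_automorphism (flats m) (spanning m) g" and gf: "\<And>X. X \<in> flats m \<Longrightarrow> g (f X) = X"
    and M: "M \<in> Max_sing"
  shows "induced m g (induced m f M) = M"
proof -
  obtain X Z where XZ: "(X, Z) \<in> spanning m" "cl (X \<union> Z) = M" using Max_sing_spanned[OF m f M] .
  have "induced m g (induced m f M) = cl (g (f X) \<union> g (f Z))"
    by (rule induced_eq[OF m g aut_spanning[OF m f XZ(1)] induced_eq[OF m f XZ, symmetric]])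
  then show ?thesis using gf spanningD[OF XZ(1)] XZ(2) by simp
qed

section \<open>Flats as intersections of maximal singular subspaces\<close>

lemma Inter_maximal: "sing U \<Longrightarrow> \<Inter>{M \<in> Max_sing. U \<subseteq> M} = U"
  using maximal_separating[of U] by blast

lemma sing_Inter:
  assumes "\<And>S. S \<in> A \<Longrightarrow> sing S" "A \<noteq> {}"
  shows "sing (\<Inter>A)"
proof -
  obtain S where S: "S \<in> A" using assms(2) by blast
  have "subspace P L (\<Inter>A)"
    unfolding subspace_def[of P L "\<Inter>A"]
  proof (intro conjI ballI impI)
    show "\<Inter>A \<subseteq> P" using S sing_carrier[OF assms(1)[OF S]] by blast
    fix x y l assume xy: "x \<in> \<Inter>A" "y \<in> \<Inter>A" and l: "l \<in> L" "x \<noteq> y \<and> x \<in> l \<and> y \<in> l"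
    have "l \<subseteq> T" if "T \<in> A" for T
      by (rule subspaceD[OF sing_subspace[OF assms(1)[OF that]], of x y]) (use that xy l in auto)
    then show "l \<subseteq> \<Inter>A" by blast
  qed
  then show ?thesis by (rule sing_subset[OF assms(1)[OF S]]) (use S in blast)
qed

lemma flat_through_point:
  assumes "sing U" "x \<in> U" "1 \<le> j" "j \<le> rk U"
  obtains X where "X \<in> flats j" "x \<in> X" "X \<subseteq> U"
proof -
  have "x \<in> P" using assms sing_carrier by blast
  then have x: "sing {x}" "rk {x} \<le> 1"
    using sing_point rk_le_card[of "{x}" "{x}"] span_point by auto
  show thesis
    by (rule flat_between[OF x(1) _ assms(1) _ assms(4)]) (use x assms that in auto)
qed

lemma flat_insert:
  assumes V: "sing V" and W: "W \<in> flats i" "W \<subseteq> V" and x: "x \<in> V" "x \<notin> W"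
  shows "cl (insert x W) \<in> flats (Suc i)" "W \<subseteq> cl (insert x W)" "x \<in> cl (insert x W)"
    "cl (insert x W) \<subseteq> V"
proof -
  have sub: "insert x W \<subseteq> V" using W x by blast
  show "cl (insert x W) \<in> flats (Suc i)"
    by (rule flatsI[OF sing_span_in[OF V sub]])
      (use rk_insert_in[OF V W(2) flats_sing[OF W(1)] x] flats_rk[OF W(1)] in simp)
  show "W \<subseteq> cl (insert x W)" "x \<in> cl (insert x W)" using in_span[of _ "insert x W"] by blast+
  show "cl (insert x W) \<subseteq> V" by (rule span_in[OF V sub])
qed

lemma two_flats_containing:
  assumes V: "sing V" and W: "W \<in> flats i" "W \<subseteq> V" and r: "Suc i < rk V"
  obtains X Y where "X \<in> flats (Suc i)" "Y \<in> flats (Suc i)" "X \<noteq> Y"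
    "W \<subseteq> X" "W \<subseteq> Y" "X \<subseteq> V" "Y \<subseteq> V"
proof -
  have "\<not> V \<subseteq> W" using rk_mono[OF flats_sing[OF W(1)] V] flats_rk[OF W(1)] r by auto
  then obtain x where x: "x \<in> V" "x \<notin> W" by blast
  note X = flat_insert[OF V W x]
  have "\<not> V \<subseteq> cl (insert x W)" using rk_mono[OF flats_sing[OF X(1)] V] flats_rk[OF X(1)] r by auto
  then obtain y where y: "y \<in> V" "y \<notin> cl (insert x W)" by blast
  have "y \<notin> W" using y X(2) by blast
  note Y = flat_insert[OF V W y(1) this]
  have "cl (insert x W) \<noteq> cl (insert y W)" using Y(3) y(2) by blast
  then show thesis using that X Y by blast
qed

lemma rk_Int_distinct_flats:
  assumes D: "sing D" and X: "X \<in> flats (Suc i)" "X \<subseteq> D" and Y: "Y \<in> flats (Suc i)" "Y \<subseteq> D"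
    and "X \<noteq> Y" and W: "W \<in> flats i" "W \<subseteq> X" "W \<subseteq> Y"
  shows "X \<inter> Y = W" "rk (cl (X \<union> Y)) = Suc (Suc i)"
proof -
  have s: "sing X" "sing Y" "sing W" "rk X = Suc i" "rk Y = Suc i" "rk W = i"
    using X Y W flats_sing flats_rk by auto
  have sXY: "sing (X \<inter> Y)" using sing_Int[OF s(1) sing_subspace[OF s(2)]] .
  have "X \<inter> Y \<noteq> X" using rk_eq_imp_eq[OF s(2,1)] s \<open>X \<noteq> Y\<close> by auto
  then have "rk (X \<inter> Y) < Suc i" using rk_strict_mono[OF s(1) sXY] s by auto
  then have "W = X \<inter> Y" using W s by (intro rk_eq_imp_eq[OF sXY s(3)]) auto
  then show "X \<inter> Y = W" by simp
  then show "rk (cl (X \<union> Y)) = Suc (Suc i)" using rk_modular[OF D X(2) Y(2) s(1,2)] s by simp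
qed

section \<open>Extending a permutation of the maximal singular subspaces\<close>

text \<open>
For a bijection \<open>g\<close> of the maximal singular subspaces that comes from an automorphism of
the geometry this is the image of \<open>U\<close>, because \<open>U\<close> is the intersection of the maximal
singular subspaces containing it. The predicate \<open>faithful g j\<close> below says that it behaves
like an image on the flats of rank \<open>j\<close>.
\<close>

definition extend :: "('a set \<Rightarrow> 'a set) \<Rightarrow> 'a set \<Rightarrow> 'a set" where
  "extend g U = \<Inter>(g ` {M \<in> Max_sing. U \<subseteq> M})"

definition faithful :: "('a set \<Rightarrow> 'a set) \<Rightarrow> nat \<Rightarrow> bool" where
  "faithful g j \<longleftrightarrow> (\<forall>X\<in>flats j. extend g X \<in> flats j \<and> (\<forall>M\<in>Max_sing. X \<subseteq> M \<longleftrightarrow> extend g X \<subseteq> g M))"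

definition inverse_on_Max :: "('a set \<Rightarrow> 'a set) \<Rightarrow> ('a set \<Rightarrow> 'a set) \<Rightarrow> bool" where
  "inverse_on_Max g h \<longleftrightarrow> (\<forall>M\<in>Max_sing. g M \<in> Max_sing \<and> h M \<in> Max_sing \<and> h (g M) = M \<and> g (h M) = M)"

lemma inverse_on_Max_sym: "inverse_on_Max g h \<Longrightarrow> inverse_on_Max h g"
  unfolding inverse_on_Max_def by blast

lemma inverse_on_MaxD:
  assumes "inverse_on_Max g h" "M \<in> Max_sing"
  shows "g M \<in> Max_sing" "h M \<in> Max_sing" "h (g M) = M" "g (h M) = M"
  using assms unfolding inverse_on_Max_def by blast+

lemma faithfulD:
  assumes "faithful g j" "X \<in> flats j"
  shows "extend g X \<in> flats j" "M \<in> Max_sing \<Longrightarrow> X \<subseteq> M \<longleftrightarrow> extend g X \<subseteq> g M"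
  using assms unfolding faithful_def by blast+

lemma extend_mono: "U \<subseteq> V \<Longrightarrow> extend g U \<subseteq> extend g V"
  unfolding extend_def by blast

lemma extend_lower: "M \<in> Max_sing \<Longrightarrow> U \<subseteq> M \<Longrightarrow> extend g U \<subseteq> g M"
  unfolding extend_def by blast

lemma extend_inverse:
  assumes gh: "inverse_on_Max g h" and f: "faithful g j" and X: "X \<in> flats j"
  shows "extend h (extend g X) = X"
proof -
  have "h ` {N \<in> Max_sing. extend g X \<subseteq> N} = {M \<in> Max_sing. X \<subseteq> M}"
  proof (intro set_eqI iffI)
    fix M assume "M \<in> h ` {N \<in> Max_sing. extend g X \<subseteq> N}"
    then obtain N where N: "N \<in> Max_sing" "extend g X \<subseteq> N" "M = h N" by auto
    have M: "M \<in> Max_sing" "g M = N" using inverse_on_MaxD[OF gh N(1)] N(3) by auto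
    then have "X \<subseteq> M" using faithfulD(2)[OF f X M(1)] N(2) by simp
    then show "M \<in> {M \<in> Max_sing. X \<subseteq> M}" using M by simp
  next
    fix M assume "M \<in> {M \<in> Max_sing. X \<subseteq> M}"
    then have M: "M \<in> Max_sing" "X \<subseteq> M" by auto
    have "g M \<in> {N \<in> Max_sing. extend g X \<subseteq> N}"
      using inverse_on_MaxD(1)[OF gh M(1)] extend_lower[OF M] by simp
    then show "M \<in> h ` {N \<in> Max_sing. extend g X \<subseteq> N}"
      using inverse_on_MaxD(3)[OF gh M(1)] by (metis image_eqI)
  qed
  then show ?thesis unfolding extend_def using Inter_maximal[OF flats_sing[OF X]] by (simp add: extend_def)
qed

lemma extend_subset_iff:
  assumes f: "faithful g j" and X: "X \<in> flats j" and U: "sing U"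
  shows "X \<subseteq> U \<longleftrightarrow> extend g X \<subseteq> extend g U"
proof
  assume a: "extend g X \<subseteq> extend g U"
  have "X \<subseteq> M" if "M \<in> Max_sing" "U \<subseteq> M" for M
    using faithfulD(2)[OF f X that(1)] extend_lower[OF that] a by blast
  then have "X \<subseteq> \<Inter>{M \<in> Max_sing. U \<subseteq> M}" by blast
  then show "X \<subseteq> U" using Inter_maximal[OF U] by simp
qed (rule extend_mono)

lemma sing_extend:
  assumes gh: "inverse_on_Max g h" and U: "sing U"
  shows "sing (extend g U)"
  unfolding extend_def
proof (rule sing_Inter)
  obtain M where "M \<in> Max_sing" "U \<subseteq> M" using sing_in_Max_sing[OF U] .
  then show "g ` {M \<in> Max_sing. U \<subseteq> M} \<noteq> {}" by blast
  fix S assume "S \<in> g ` {M \<in> Max_sing. U \<subseteq> M}"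
  then show "sing S" using inverse_on_MaxD(1)[OF gh] Max_sing_sing by auto
qed

lemma extend_strict_mono:
  assumes f: "faithful g j" "1 \<le> j" and U: "sing U" and V: "sing V" "j \<le> rk V" and UV: "U \<subset> V"
  shows "extend g U \<subset> extend g V"
proof -
  obtain x where x: "x \<in> V" "x \<notin> U" using UV by blast
  obtain X where X: "X \<in> flats j" "x \<in> X" "X \<subseteq> V" using flat_through_point[OF V(1) x(1) f(2) V(2)] .
  have "extend g X \<subseteq> extend g V" by (rule extend_mono[OF X(3)])
  moreover have "\<not> extend g X \<subseteq> extend g U" using extend_subset_iff[OF f(1) X(1) U] X x by blast
  moreover have "extend g U \<subseteq> extend g V" by (rule extend_mono) (use UV in blast)
  ultimately show ?thesis by blast
qed

text \<open>
Strict monotonicity along a chain from \<open>U\<close> up to a maximal singular subspace bounds the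
rank of \<open>extend g U\<close> from above, and along a chain from \<open>U\<close> down to rank \<open>j\<close> from below.
\<close>

lemma rk_extend:
  assumes gh: "inverse_on_Max g h" and f: "faithful g j" "1 \<le> j" and U: "sing U" "j \<le> rk U"
  shows "rk (extend g U) = rk U"
proof (rule antisym)
  show "rk (extend g U) \<le> rk U"
    using U
  proof (induction "n - rk U" arbitrary: U rule: less_induct)
    case less
    show ?case
    proof (cases "rk U = n")
      case True
      then have "U \<in> Max_sing" using Max_iff_rk less.prems by blast
      then have "extend g U \<subseteq> g U" "g U \<in> Max_sing"
        using extend_lower inverse_on_MaxD(1)[OF gh] by auto
      then have "rk (extend g U) \<le> n"
        using rk_le_n[OF sing_extend[OF gh less.prems(1)]] by simp
      then show ?thesis using True by simp
    next
      case False
      then have lt: "rk U < n" using rk_le_n[OF less.prems(1)] by simp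
      obtain M where M: "M \<in> Max_sing" "U \<subseteq> M" using sing_in_Max_sing[OF less.prems(1)] .
      have "U \<noteq> M" using lt Max_rk[OF M(1)] by auto
      then obtain x where x: "x \<in> M" "x \<notin> U" using M by blast
      note V = flat_insert[OF Max_sing_sing[OF M(1)] flatsI[OF less.prems(1) refl] M(2) x]
      let ?V = "cl (insert x U)"
      have sV: "sing ?V" "rk ?V = Suc (rk U)" using V(1) flats_sing flats_rk by auto
      have "U \<subset> ?V" using V x by blast
      then have "extend g U \<subset> extend g ?V"
        using less.prems sV by (intro extend_strict_mono[OF f less.prems(1) sV(1)]) auto
      then have "rk (extend g U) < rk (extend g ?V)"
        using rk_strict_mono sing_extend[OF gh] sV less.prems by blast
      also have "\<dots> \<le> rk ?V" using lt sV less.prems by (intro less.hyps) auto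
      finally show ?thesis using sV by simp
    qed
  qed
  show "rk U \<le> rk (extend g U)"
    using U
  proof (induction "rk U" arbitrary: U rule: less_induct)
    case less
    show ?case
    proof (cases "rk U = j")
      case True
      then show ?thesis using faithfulD(1)[OF f(1) flatsI[OF less.prems(1)]] flats_rk by auto
    next
      case False
      then obtain i where i: "rk U = Suc i" "j \<le> i" using less.prems(2) by (cases "rk U") auto
      obtain V where V: "V \<in> flats i" "V \<subseteq> U"
        using flat_between[OF sing_empty _ less.prems(1), of i] i by auto
      have sV: "sing V" "rk V = i" using V flats_sing flats_rk by auto
      have "V \<subset> U" using V sV i by auto
      then have "extend g V \<subset> extend g U" by (rule extend_strict_mono[OF f sV(1) less.prems])
      then have "rk (extend g V) < rk (extend g U)"
        using rk_strict_mono sing_extend[OF gh] sV less.prems by blast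
      moreover have "rk V \<le> rk (extend g V)" using sV i by (intro less.hyps) auto
      ultimately show ?thesis using sV i by simp
    qed
  qed
qed

text \<open>
A subspace of rank at least \<open>j\<close> is the union of its flats of rank \<open>j\<close>.
\<close>

lemma faithful_upward:
  assumes gh: "inverse_on_Max g h" and f: "faithful g j" "1 \<le> j" and "j \<le> d"
  shows "faithful g d"
  unfolding faithful_def
proof (intro ballI)
  fix U assume "U \<in> flats d"
  then have U: "sing U" "rk U = d" using flats_sing flats_rk by auto
  have "extend g U \<in> flats d"
    using rk_extend[OF gh f U(1)] U(2) assms(4) by (intro flatsI[OF sing_extend[OF gh U(1)]]) simp
  moreover have "U \<subseteq> M" if M: "M \<in> Max_sing" "extend g U \<subseteq> g M" for M
  proof
    fix x assume x: "x \<in> U"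
    have "j \<le> rk U" using U(2) assms(4) by simp
    then obtain X where X: "X \<in> flats j" "x \<in> X" "X \<subseteq> U" using flat_through_point[OF U(1) x f(2)] by metis
    have "extend g X \<subseteq> g M" using extend_mono[OF X(3), of g] M(2) by blast
    then show "x \<in> M" using faithfulD(2)[OF f(1) X(1) M(1)] X(2) by blast
  qed
  ultimately show "extend g U \<in> flats d \<and> (\<forall>M\<in>Max_sing. (U \<subseteq> M) = (extend g U \<subseteq> g M))"
    by (simp add: extend_lower iff_conv_conj_imp)
qed

section \<open>Descending one rank\<close>

context
  fixes g h :: "'a set \<Rightarrow> 'a set" and i :: nat
  assumes gh: "inverse_on_Max g h" and fg: "faithful g (Suc i)" and i: "i + 3 \<le> n"
begin

lemma extend_flat: "X \<in> flats (Suc i) \<Longrightarrow> extend g X \<in> flats (Suc i)"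
  by (rule faithfulD(1)[OF fg])

lemma extend_inj:
  assumes "X \<in> flats (Suc i)" "Y \<in> flats (Suc i)" "X \<noteq> Y"
  shows "extend g X \<noteq> extend g Y"
  using extend_inverse[OF gh fg assms(1)] extend_inverse[OF gh fg assms(2)] assms(3) by metis

text \<open>
The images of two flats that meet in a hyperplane of both do so as well, since the image
of their span has the rank of their span.
\<close>

lemma extend_span:
  assumes M: "M \<in> Max_sing" and X: "X \<in> flats (Suc i)" "X \<subseteq> M" and Y: "Y \<in> flats (Suc i)" "Y \<subseteq> M"
    and XY: "X \<noteq> Y" and W: "W \<in> flats i" "W \<subseteq> X" "W \<subseteq> Y"
  shows "extend g X \<inter> extend g Y \<in> flats i" "cl (extend g X \<union> extend g Y) = extend g (cl (X \<union> Y))"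
proof -
  let ?D = "cl (X \<union> Y)" and ?A = "extend g X" and ?B = "extend g Y"
  have sM: "sing M" by (rule Max_sing_sing[OF M])
  have sub: "X \<union> Y \<subseteq> M" using X Y by blast
  have D: "sing ?D" "rk ?D = Suc (Suc i)"
    using sing_span_in[OF sM sub] rk_Int_distinct_flats(2)[OF sM X Y XY W] by auto
  have E: "sing (extend g ?D)" "rk (extend g ?D) = Suc (Suc i)"
    using sing_extend[OF gh D(1)] rk_extend[OF gh fg _ D(1)] D(2) by auto
  have A: "?A \<in> flats (Suc i)" "?A \<subseteq> extend g ?D" and B: "?B \<in> flats (Suc i)" "?B \<subseteq> extend g ?D"
    using extend_flat[OF X(1)] extend_flat[OF Y(1)] extend_mono[of X ?D g] extend_mono[of Y ?D g]
      in_span[of _ "X \<union> Y"] by blast+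
  have AB: "?A \<noteq> ?B" by (rule extend_inj[OF X(1) Y(1) XY])
  have s: "sing ?A" "sing ?B" "rk ?A = Suc i" "rk ?B = Suc i" using A B flats_sing flats_rk by auto
  have ABD: "?A \<union> ?B \<subseteq> extend g ?D" using A B by blast
  note J = sing_span_in[OF E(1) ABD] span_in[OF E(1) ABD]
  have "\<not> ?B \<subseteq> ?A" using rk_eq_imp_eq[OF s(1,2)] s AB by auto
  then have "?A \<subset> cl (?A \<union> ?B)" using in_span[of _ "?A \<union> ?B"] by blast
  then have "Suc i < rk (cl (?A \<union> ?B))" using rk_strict_mono[OF J(1) s(1)] s by simp
  then show eq: "cl (?A \<union> ?B) = extend g ?D" using E(2) by (intro rk_eq_imp_eq[OF E(1) J]) simp
  show "?A \<inter> ?B \<in> flats i"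
  proof (rule flatsI)
    show "sing (?A \<inter> ?B)" using sing_Int[OF s(1) sing_subspace[OF s(2)]] .
    show "rk (?A \<inter> ?B) = i" using rk_modular[OF E(1) A(2) B(2) s(1,2)] eq E(2) s by simp
  qed
qed

text \<open>
Three flats of rank \<open>i + 1\<close> that pairwise meet in rank \<open>i\<close>, and do not all lie in one flat
of rank \<open>i + 2\<close>, share their intersection. The images of \<open>X\<close>, \<open>Y\<close>, \<open>Z\<close> are of this kind.
\<close>

lemma extend_Int_eq:
  assumes M: "M \<in> Max_sing" and X: "X \<in> flats (Suc i)" "X \<subseteq> M" and Y: "Y \<in> flats (Suc i)" "Y \<subseteq> M"
    and Z: "Z \<in> flats (Suc i)" "Z \<subseteq> M" "\<not> Z \<subseteq> cl (X \<union> Y)"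
    and XY: "X \<noteq> Y" and W: "W \<in> flats i" "W \<subseteq> X" "W \<subseteq> Y" "W \<subseteq> Z"
  shows "extend g X \<inter> extend g Z = extend g X \<inter> extend g Y"
proof -
  let ?D = "cl (X \<union> Y)" and ?A = "extend g X" and ?B = "extend g Y" and ?C = "extend g Z"
  have sM: "sing M" by (rule Max_sing_sing[OF M])
  have "X \<union> Y \<subseteq> M" using X Y by blast
  then have D: "sing ?D" by (rule sing_span_in[OF sM])
  have sub: "X \<subseteq> ?D" "Y \<subseteq> ?D" using in_span[of _ "X \<union> Y"] by auto
  then have ne: "X \<noteq> Z" "Y \<noteq> Z" using Z by auto
  note AB = extend_span(1)[OF M X Y XY W(1-3)]
  note AC = extend_span(1)[OF M X Z(1,2) ne(1) W(1,2,4)]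
  note BC = extend_span(1)[OF M Y Z(1,2) ne(2) W(1,3,4)]
  let ?E = "extend g ?D"
  have AE: "?A \<subseteq> ?E" "?B \<subseteq> ?E" using extend_mono sub by auto
  have C: "sing ?C" "rk ?C = Suc i" using extend_flat[OF Z(1)] flats_sing flats_rk by auto
  have CE: "sing (?C \<inter> ?E)" using sing_Int[OF C(1) sing_subspace[OF sing_extend[OF gh D]]] .
  have "\<not> ?C \<subseteq> ?E" using extend_subset_iff[OF fg Z(1) D] Z(3) by blast
  then have "rk (?C \<inter> ?E) < Suc i" using rk_strict_mono[OF C(1) CE] C(2) by auto
  then have le: "rk (?C \<inter> ?E) \<le> i" by simp
  have "?A \<inter> ?C = ?C \<inter> ?E"
    by (rule rk_eq_imp_eq[OF CE flats_sing[OF AC]]) (use AE le flats_rk[OF AC] in auto)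
  moreover have "?B \<inter> ?C = ?C \<inter> ?E"
    by (rule rk_eq_imp_eq[OF CE flats_sing[OF BC]]) (use AE le flats_rk[OF BC] in auto)
  ultimately have "?A \<inter> ?C \<subseteq> ?A \<inter> ?B" by blast
  then show ?thesis
    using flats_rk[OF AB] flats_rk[OF AC]
    by (intro rk_eq_imp_eq[OF flats_sing[OF AB] flats_sing[OF AC]]) auto
qed

text \<open>
If \<open>Z\<close> lies in the span of \<open>X\<close> and \<open>Y\<close>, compare both pairs \<open>X\<close>, \<open>Y\<close> and \<open>X\<close>, \<open>Z\<close> with a flat
through \<open>W\<close> outside this span. The rank of the span is \<open>i + 2\<close>, less than \<open>n\<close>, so there is
one in \<open>M\<close>.
\<close>

lemma extend_Int_subset:
  assumes M: "M \<in> Max_sing" and X: "X \<in> flats (Suc i)" "X \<subseteq> M" and Y: "Y \<in> flats (Suc i)" "Y \<subseteq> M"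
    and Z: "Z \<in> flats (Suc i)" "Z \<subseteq> M"
    and XY: "X \<noteq> Y" and W: "W \<in> flats i" "W \<subseteq> X" "W \<subseteq> Y" "W \<subseteq> Z"
  shows "extend g X \<inter> extend g Y \<subseteq> extend g Z"
proof (cases "Z \<subseteq> cl (X \<union> Y) \<and> X \<noteq> Z")
  case False
  then show ?thesis using extend_Int_eq[OF M X Y Z _ XY W] by blast
next
  case True
  have sM: "sing M" by (rule Max_sing_sing[OF M])
  have sub: "X \<union> Y \<subseteq> M" "W \<subseteq> M" using X Y W by auto
  have "rk (cl (X \<union> Y)) = Suc (Suc i)" by (rule rk_Int_distinct_flats(2)[OF sM X Y XY W(1-3)])
  then have "\<not> M \<subseteq> cl (X \<union> Y)"
    using rk_mono[OF sing_span_in[OF sM sub(1)] sM] Max_rk[OF M] i by auto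
  then obtain x where x: "x \<in> M" "x \<notin> cl (X \<union> Y)" by blast
  have sXY: "X \<subseteq> cl (X \<union> Y)" "Y \<subseteq> cl (X \<union> Y)" using in_span[of _ "X \<union> Y"] by auto
  then have "x \<notin> W" using W(2) x(2) by blast
  note T = flat_insert[OF sM W(1) sub(2) x(1) this]
  have T1: "\<not> cl (insert x W) \<subseteq> cl (X \<union> Y)" using T(3) x(2) by blast
  have "cl (X \<union> Z) \<subseteq> cl (X \<union> Y)"
    by (rule span_in[OF sing_span_in[OF sM sub(1)]]) (use True sXY in blast)
  then have T2: "\<not> cl (insert x W) \<subseteq> cl (X \<union> Z)" using T1 by blast
  have "extend g X \<inter> extend g Y = extend g X \<inter> extend g (cl (insert x W))"
    by (rule extend_Int_eq[OF M X Y T(1,4) T1 XY W(1-3) T(2), symmetric])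
  also have "\<dots> = extend g X \<inter> extend g Z"
    by (rule extend_Int_eq[OF M X Z T(1,4) T2 _ W(1,2,4) T(2)]) (use True in simp)
  finally show ?thesis by blast
qed

text \<open>
The candidate \<open>extend g X \<inter> extend g Y\<close> for the image of \<open>W\<close> lies in the images of all flats
of rank \<open>i + 1\<close> through \<open>W\<close>: within one maximal singular subspace by the previous lemma,
and across two of them that meet in a hyperplane because this hyperplane, of rank at
least \<open>i + 2\<close>, contains two such flats, which determine the candidate for both.
\<close>

lemma extend_eq_Int:
  assumes M: "M \<in> Max_sing" and X: "X \<in> flats (Suc i)" "X \<subseteq> M" and Y: "Y \<in> flats (Suc i)" "Y \<subseteq> M"
    and XY: "X \<noteq> Y" and W: "W \<in> flats i" "W \<subseteq> X" "W \<subseteq> Y"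
  shows "extend g W = extend g X \<inter> extend g Y"
proof
  show "extend g W \<subseteq> extend g X \<inter> extend g Y" using extend_mono W by blast
  let ?w = "extend g X \<inter> extend g Y"
  have w: "?w \<in> flats i" by (rule extend_span(1)[OF M X Y XY W])
  have all: "\<forall>Z\<in>flats (Suc i). W \<subseteq> Z \<longrightarrow> Z \<subseteq> N \<longrightarrow> ?w \<subseteq> extend g Z"
    if N: "N \<in> Max_sing" "W \<subseteq> N" for N
  proof (rule maximal_connected[OF M N(1), of W])
    show "W \<subseteq> M \<inter> N" using W X N by blast
    show "\<forall>Z\<in>flats (Suc i). W \<subseteq> Z \<longrightarrow> Z \<subseteq> M \<longrightarrow> ?w \<subseteq> extend g Z"
      using extend_Int_subset[OF M X Y _ _ XY W] by blast
    fix N N'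
    assume N: "N \<in> Max_sing" and N': "N' \<in> Max_sing" and WN: "W \<subseteq> N \<inter> N'"
      and r: "Suc (rk (N \<inter> N')) = n"
      and IH: "\<forall>Z\<in>flats (Suc i). W \<subseteq> Z \<longrightarrow> Z \<subseteq> N \<longrightarrow> ?w \<subseteq> extend g Z"
    have sI: "sing (N \<inter> N')" using sing_Int Max_sing_sing sing_subspace N N' by blast
    have "Suc i < rk (N \<inter> N')" using r i by simp
    then obtain A B where A: "A \<in> flats (Suc i)" "W \<subseteq> A" "A \<subseteq> N \<inter> N'"
      and B: "B \<in> flats (Suc i)" "W \<subseteq> B" "B \<subseteq> N \<inter> N'" and AB: "A \<noteq> B"
      using two_flats_containing[OF sI W(1) WN] by metis
    have A': "A \<subseteq> N'" "B \<subseteq> N'" using A B by auto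
    have v: "extend g A \<inter> extend g B \<in> flats i"
      by (rule extend_span(1)[OF N' A(1) A'(1) B(1) A'(2) AB W(1) A(2) B(2)])
    have "?w \<subseteq> extend g A \<inter> extend g B" using IH A B by blast
    then have eq: "?w = extend g A \<inter> extend g B"
      using flats_rk[OF v] flats_rk[OF w] by (intro rk_eq_imp_eq[OF flats_sing[OF v] flats_sing[OF w]]) auto
    show "\<forall>Z\<in>flats (Suc i). W \<subseteq> Z \<longrightarrow> Z \<subseteq> N' \<longrightarrow> ?w \<subseteq> extend g Z"
      unfolding eq using extend_Int_subset[OF N' A(1) A'(1) B(1) A'(2) _ _ AB W(1) A(2) B(2)] by blast
  qed
  have "?w \<subseteq> g N" if N: "N \<in> Max_sing" "W \<subseteq> N" for N
  proof -
    obtain Z where Z: "Z \<in> flats (Suc i)" "W \<subseteq> Z" "Z \<subseteq> N"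
      by (rule flat_between[OF flats_sing[OF W(1)] _ Max_sing_sing[OF N(1)] N(2), of "Suc i"])
        (use flats_rk[OF W(1)] Max_rk[OF N(1)] i in auto)
    then have "?w \<subseteq> extend g Z" using all[OF N] by blast
    also have "\<dots> \<subseteq> g N" by (rule extend_lower[OF N(1) Z(3)])
    finally show ?thesis .
  qed
  then show "?w \<subseteq> extend g W" unfolding extend_def[of g W] by blast
qed

end

text \<open>
Applying the description of the image of \<open>W\<close> as an intersection to \<open>g\<close> and then to its
inverse \<open>h\<close> returns \<open>W\<close>; this gives the converse direction of the incidence condition.
\<close>

lemma faithful_descend:
  assumes gh: "inverse_on_Max g h" and fg: "faithful g (Suc i)" and fh: "faithful h (Suc i)"
    and i: "i + 3 \<le> n"
  shows "faithful g i"
  unfolding faithful_def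
proof (intro ballI)
  fix W assume W: "W \<in> flats i"
  have hg: "inverse_on_Max h g" by (rule inverse_on_Max_sym[OF gh])
  obtain M where M: "M \<in> Max_sing" "W \<subseteq> M" using sing_in_Max_sing[OF flats_sing[OF W]] .
  have "Suc i < rk M" using Max_rk[OF M(1)] i by simp
  then obtain X Y where X: "X \<in> flats (Suc i)" "X \<subseteq> M" and Y: "Y \<in> flats (Suc i)" "Y \<subseteq> M"
    and XY: "X \<noteq> Y" and WX: "W \<subseteq> X" "W \<subseteq> Y"
    using two_flats_containing[OF Max_sing_sing[OF M(1)] W M(2)] by metis
  note eq = extend_eq_Int[OF gh fg i M(1) X Y XY W WX]
  have gW: "extend g W \<in> flats i" using extend_span(1)[OF gh fg i M(1) X Y XY W WX] eq by simp
  have sub: "extend g X \<subseteq> g M" "extend g Y \<subseteq> g M" "extend g W \<subseteq> extend g X" "extend g W \<subseteq> extend g Y"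
    using extend_lower M(1) X Y extend_mono WX by auto
  have "extend h (extend g W) = extend h (extend g X) \<inter> extend h (extend g Y)"
    by (rule extend_eq_Int[OF hg fh i inverse_on_MaxD(1)[OF gh M(1)] extend_flat[OF gh fg i X(1)] sub(1)
          extend_flat[OF gh fg i Y(1)] sub(2) extend_inj[OF gh fg i X(1) Y(1) XY] gW sub(3,4)])
  also have "\<dots> = W"
    using extend_inverse[OF gh fg X(1)] extend_inverse[OF gh fg Y(1)]
      rk_Int_distinct_flats(1)[OF Max_sing_sing[OF M(1)] X Y XY W WX] by simp
  finally have inv: "extend h (extend g W) = W" .
  have "W \<subseteq> N \<longleftrightarrow> extend g W \<subseteq> g N" if N: "N \<in> Max_sing" for N
  proof
    assume "extend g W \<subseteq> g N"
    then have "extend h (extend g W) \<subseteq> h (g N)" by (rule extend_lower[OF inverse_on_MaxD(1)[OF gh N]])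
    then show "W \<subseteq> N" using inv inverse_on_MaxD(3)[OF gh N] by simp
  qed (rule extend_lower[OF N])
  then show "extend g W \<in> flats i \<and> (\<forall>M\<in>Max_sing. (W \<subseteq> M) = (extend g W \<subseteq> g M))"
    using gW by blast
qed

lemma faithful_points:
  assumes gh: "inverse_on_Max g h" and "faithful g j" "faithful h j" and j: "1 \<le> j" "j + 2 \<le> n"
  shows "faithful g 1 \<and> faithful h 1"
  using assms(2-)
proof (induction j)
  case (Suc i)
  show ?case
  proof (cases "i = 0")
    case True
    then show ?thesis using Suc.prems by simp
  next
    case False
    have i: "i + 3 \<le> n" using Suc.prems by simp
    show ?thesis
      using faithful_descend[OF gh Suc.prems(1,2) i]
        faithful_descend[OF inverse_on_Max_sym[OF gh] Suc.prems(2,1) i] Suc False by simp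
  qed
qed simp

section \<open>From points to the geometry\<close>

lemma flats_1: "X \<in> flats 1 \<longleftrightarrow> (\<exists>p\<in>P. X = {p})"
proof
  assume X: "X \<in> flats 1"
  then have s: "sing X" "rk X = 1" using flats_sing flats_rk by auto
  then obtain p where p: "p \<in> X" using rk_empty by fastforce
  have pP: "p \<in> P" using p sing_carrier[OF s(1)] by blast
  have "rk {p} = 1" using rk_insert[OF sing_empty, of p] pP span_point[OF pP] unfolding perp_def by simp
  then have "{p} = X" using rk_eq_imp_eq[OF s(1) sing_point[OF pP]] p s by simp
  then show "\<exists>p\<in>P. X = {p}" using pP by blast
next
  assume "\<exists>p\<in>P. X = {p}"
  then obtain p where p: "p \<in> P" "X = {p}" by blast
  have "rk {p} = 1" using rk_insert[OF sing_empty, of p] p span_point[OF p(1)] unfolding perp_def by simp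
  then show "X \<in> flats 1" using p sing_point flatsI by simp
qed

lemma flats_2: "flats 2 = L"
proof (intro set_eqI iffI)
  fix X assume X: "X \<in> flats 2"
  then have s: "sing X" "rk X = 2" using flats_sing flats_rk by auto
  then obtain x where x: "x \<in> X" using rk_empty by fastforce
  have xP: "x \<in> P" using x sing_carrier[OF s(1)] by blast
  have "{x} \<in> flats 1" using flats_1 xP by blast
  then have rx: "rk {x} = 1" by (rule flats_rk)
  then have "X \<noteq> {x}" using s by auto
  then obtain y where y: "y \<in> X" "y \<noteq> x" using x by blast
  have "rk (cl {y, x}) = 2" using rk_insert_in[OF s(1) _ sing_point[OF xP] y(1)] x y rx by simp
  then have "cl {y, x} = X"
    using s x y by (intro rk_eq_imp_eq[OF s(1) sing_span_in[OF s(1)] span_in[OF s(1)]]) auto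
  then show "X \<in> L" using sing_line_through[OF s(1) y(1) x y(2)] by simp
next
  fix l assume l: "l \<in> L"
  obtain x y where xy: "x \<in> l" "y \<in> l" "x \<noteq> y" using line_two_points[OF l] by blast
  have P: "x \<in> P" "y \<in> P" using xy line_proper[OF l] by auto
  have eq: "cl {x, y} = l" by (rule span_line[OF l xy])
  have xo: "x \<in> orth {y}" using P l xy unfolding perp_def collinear_def by auto
  have "rk {y} = 1" using flats_1 P flats_rk by blast
  then have "rk l = 2" using rk_insert[OF sing_point[OF P(2)] xo] xy eq by simp
  moreover have "sing l" using sing_span_insert[OF sing_point[OF P(2)] xo] eq by simp
  ultimately show "l \<in> flats 2" by (intro flatsI)
qed

text \<open>
Singletons are the flats of rank 1 and lines those of rank 2, so \<open>extend g\<close> on the former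
is a permutation of the points, and on the latter it shows that this permutation
preserves lines.
\<close>

lemma faithful_imp_geometry_automorphism:
  assumes gh: "inverse_on_Max g h" and fg: "faithful g 1" and fh: "faithful h 1"
  obtains \<phi> where "geometry_automorphism P L \<phi>"
    "\<And>U. sing U \<Longrightarrow> 1 \<le> rk U \<Longrightarrow> extend g U = \<phi> ` U"
proof -
  have hg: "inverse_on_Max h g" by (rule inverse_on_Max_sym[OF gh])
  have "\<exists>q. q \<in> P \<and> extend g {p} = {q}" if "p \<in> P" for p
    using faithfulD(1)[OF fg, of "{p}"] that flats_1 by auto
  then obtain \<phi> where \<phi>: "\<And>p. p \<in> P \<Longrightarrow> \<phi> p \<in> P" "\<And>p. p \<in> P \<Longrightarrow> extend g {p} = {\<phi> p}" by metis
  have preimage: "\<exists>p\<in>P. \<phi> p = q \<and> extend h {q} = {p}" if q: "q \<in> P" for q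
  proof -
    have q1: "{q} \<in> flats 1" using q flats_1 by blast
    obtain p where p: "p \<in> P" "extend h {q} = {p}" using faithfulD(1)[OF fh q1] flats_1 by auto
    have "extend g {p} = {q}" using extend_inverse[OF hg fh q1] p by simp
    then show ?thesis using \<phi>(2)[OF p(1)] p by auto
  qed
  have extend_image: "extend g U = \<phi> ` U" if U: "sing U" "1 \<le> rk U" for U
  proof (intro set_eqI iffI)
    fix q assume q: "q \<in> extend g U"
    then obtain p where p: "p \<in> P" "\<phi> p = q" using preimage sing_carrier[OF sing_extend[OF gh U(1)]] by blast
    then have "{p} \<subseteq> U" using extend_subset_iff[OF fg, of "{p}" U] U(1) flats_1 \<phi>(2)[OF p(1)] q by auto
    then show "q \<in> \<phi> ` U" using p by blast
  next
    fix q assume "q \<in> \<phi> ` U"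
    then obtain p where p: "p \<in> U" "q = \<phi> p" by blast
    have "extend g {p} \<subseteq> extend g U" by (rule extend_mono) (use p in simp)
    then show "q \<in> extend g U" using \<phi>(2)[of p] p sing_carrier[OF U(1)] by auto
  qed
  have inj: "inj_on \<phi> P"
  proof (rule inj_onI)
    fix p q assume pq: "p \<in> P" "q \<in> P" "\<phi> p = \<phi> q"
    then have "extend g {p} = extend g {q}" using \<phi>(2) by simp
    moreover have "{p} \<in> flats 1" "{q} \<in> flats 1" using pq flats_1 by blast+
    ultimately have "{p} = {q}" using extend_inverse[OF gh fg] by metis
    then show "p = q" by simp
  qed
  have "\<phi> ` P \<subseteq> P" using \<phi>(1) by blast
  moreover have "P \<subseteq> \<phi> ` P"
  proof
    fix q assume "q \<in> P"
    then obtain p where "p \<in> P" "\<phi> p = q" using preimage by metis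
    then show "q \<in> \<phi> ` P" by blast
  qed
  ultimately have "\<phi> ` P = P" by (rule antisym)
  with inj have bij: "bij_betw \<phi> P P" unfolding bij_betw_def by simp
  have line: "extend g l = \<phi> ` l" "extend g l \<in> L" if "l \<in> L" for l
  proof -
    have s: "sing l" "rk l = 2" using that flats_2 flats_sing flats_rk by auto
    show "extend g l = \<phi> ` l" by (rule extend_image) (use s in auto)
    have "extend g l \<in> flats 2"
      by (rule flatsI[OF sing_extend[OF gh s(1)]]) (use rk_extend[OF gh fg _ s(1)] s in simp)
    then show "extend g l \<in> L" using flats_2 by blast
  qed
  have onto: "l \<in> (\<lambda>l. \<phi> ` l) ` L" if "l \<in> L" for l
  proof -
    have s: "sing l" "rk l = 2" using that flats_2 flats_sing flats_rk by auto
    have "extend h l \<in> flats 2"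
      by (rule flatsI[OF sing_extend[OF hg s(1)]]) (use rk_extend[OF hg fh _ s(1)] s in simp)
    then have h2: "extend h l \<in> L" using flats_2 by blast
    have fh2: "faithful h 2" by (rule faithful_upward[OF hg fh]) simp_all
    have "extend g (extend h l) = l" by (rule extend_inverse[OF hg fh2]) (use that flats_2 in simp)
    then have "l = \<phi> ` extend h l" using line(1)[OF h2] by simp
    then show ?thesis using h2 by (rule image_eqI)
  qed
  have "(\<lambda>l. \<phi> ` l) ` L \<subseteq> L" using line by auto
  then have "(\<lambda>l. \<phi> ` l) ` L = L" using onto by blast
  with bij have "geometry_automorphism P L \<phi>" unfolding geometry_automorphism_def by simp
  then show thesis using that extend_image by blast
qed

end

theorem theorem2:
  fixes P :: "'a set" and L :: "'a set set" and n :: nat and t k :: int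
    and f :: "'a set \<Rightarrow> 'a set"
  assumes "polar_space_of_rank P L n"
    and "int n \<ge> 2 * t" and "2 * t \<ge> 4"
    and "k = int n - t - 1"
    and "graph_automorphism (polar_grassmannian P L k) (rel_0 P L k t) f"
  shows "\<exists>\<phi>. geometry_automorphism P L \<phi> \<and> (\<forall>X \<in> polar_grassmannian P L k. f X = \<phi> ` X)"
proof -
  interpret polar_space_of_rank P L n by fact
  define m where "m = nat (int n - t)"
  have m: "int m = int n - t" "n \<le> 2 * m" "m + 2 \<le> n" "1 \<le> m"
    using assms(2,3) unfolding m_def by linarith+
  have graph: "polar_grassmannian P L k = flats m" "rel_0 P L k t = spanning m"
    using rel_0_eq_spanning[OF assms(4) m(1)] assms(2,3) m(1) by auto
  let ?f' = "inv_into (flats m) f"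
  have f: "graph_automorphism (flats m) (spanning m) f" using assms(5) graph by simp
  have f': "graph_automorphism (flats m) (spanning m) ?f'" by (rule inverse_automorphism[OF f])
  have bij: "bij_betw f (flats m) (flats m)" using f unfolding graph_automorphism_def by simp
  have left: "?f' (f X) = X" and right: "f (?f' X) = X" if "X \<in> flats m" for X
    using bij_betw_inv_into_left[OF bij that] bij_betw_inv_into_right[OF bij that] by auto
  let ?g = "induced m f" and ?h = "induced m ?f'"
  have gh: "inverse_on_Max ?g ?h"
    unfolding inverse_on_Max_def
    using induced_Max[OF m(2,3) f] induced_Max[OF m(2,3) f']
      induced_inverse[OF m(2,3) f f' left] induced_inverse[OF m(2,3) f' f right] by blast
  have extend_f: "faithful (induced m u) m \<and> (\<forall>X\<in>flats m. extend (induced m u) X = u X)"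
    if u: "graph_automorphism (flats m) (spanning m) u" and v: "graph_automorphism (flats m) (spanning m) v"
      and vu: "\<And>X. X \<in> flats m \<Longrightarrow> v (u X) = X"
      and inv: "inverse_on_Max (induced m u) (induced m v)" for u v
  proof -
    have iff: "X \<subseteq> M \<longleftrightarrow> u X \<subseteq> induced m u M" if X: "X \<in> flats m" and M: "M \<in> Max_sing" for X M
    proof
      assume "u X \<subseteq> induced m u M"
      then have "v (u X) \<subseteq> induced m v (induced m u M)"
        by (rule induced_mono[OF m(2,3) v aut_flats[OF m(2,3) u X]])
      then show "X \<subseteq> M" using vu[OF X] inverse_on_MaxD(3)[OF inv M] by simp
    qed (rule induced_mono[OF m(2,3) u X])
    have ext: "extend (induced m u) X = u X" if X: "X \<in> flats m" for X
    proof -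
      have uX: "u X \<in> flats m" by (rule aut_flats[OF m(2,3) u X])
      have "induced m u ` {M \<in> Max_sing. X \<subseteq> M} = {N \<in> Max_sing. u X \<subseteq> N}"
      proof (intro set_eqI iffI)
        fix N assume "N \<in> {N \<in> Max_sing. u X \<subseteq> N}"
        then have N: "N \<in> Max_sing" "u X \<subseteq> N" by auto
        note M = inverse_on_MaxD(2,4)[OF inv N(1)]
        have "X \<subseteq> induced m v N" using iff[OF X M(1)] M(2) N(2) by simp
        then show "N \<in> induced m u ` {M \<in> Max_sing. X \<subseteq> M}"
          using M by (metis (mono_tags, lifting) image_eqI mem_Collect_eq)
      next
        fix N assume "N \<in> induced m u ` {M \<in> Max_sing. X \<subseteq> M}"
        then obtain M where M: "M \<in> Max_sing" "X \<subseteq> M" "N = induced m u M" by auto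
        then show "N \<in> {N \<in> Max_sing. u X \<subseteq> N}"
          using iff[OF X M(1)] inverse_on_MaxD(1)[OF inv M(1)] by simp
      qed
      then show ?thesis unfolding extend_def using Inter_maximal[OF flats_sing[OF uX]] by simp
    qed
    then show ?thesis
      unfolding faithful_def using iff aut_flats[OF m(2,3) u] by simp
  qed
  have g: "faithful ?g m" "\<And>X. X \<in> flats m \<Longrightarrow> extend ?g X = f X"
    using extend_f[OF f f' left gh] by auto
  have h: "faithful ?h m" using extend_f[OF f' f right inverse_on_Max_sym[OF gh]] by auto
  have "faithful ?g 1" "faithful ?h 1" using faithful_points[OF gh g(1) h m(4,3)] by auto
  then obtain \<phi> where \<phi>: "geometry_automorphism P L \<phi>"
    "\<And>U. sing U \<Longrightarrow> 1 \<le> rk U \<Longrightarrow> extend ?g U = \<phi> ` U"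
    using faithful_imp_geometry_automorphism[OF gh] by metis
  have "f X = \<phi> ` X" if "X \<in> flats m" for X
    using g(2)[OF that] \<phi>(2)[OF flats_sing[OF that]] flats_rk[OF that] m(4) by simp
  then show ?thesis using \<phi>(1) graph by auto
qed

end
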